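(* Let $\mathbb{F}_q$ be a finite field of characteristic $p$, and let $a_1,\dots,a_5,b_1,\dots,b_5\in\mathbb{F}_q$. Consider the quadratic polynomial system $F=(f_1,f_2)$ given by $$f_1(x,y)=a_1x^2+a_2xy+a_3y^2+a_4x+a_5y,\qquad f_2(x,y)=b_1x^2+b_2xy+b_3y^2+b_4x+b_5y.$$ Then $F$ is a permutation of $\mathbb{F}_q^2$ if and only if: (i) when $p$ is odd, $F\sim(x,y)$; (ii) when $p$ is even, $F\sim(x,y)$, or $F\sim(x^2,y)$, or $F\sim(x,y^2)$, or $F\sim(x^2,y^2)$, or $F\sim(y^2+x,\ c_1x^2+c_2y^2+c_3x+c_4y)$ for some $c_1,c_2,c_3,c_4\in\mathbb{F}_q$ such that the linearized polynomial $c_1y^4+(c_2+c_3)y^2+c_4y$ is a permutation polynomial of $\mathbb{F}_q$.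
   Context: A system $(f_1,\dots,f_n)$ with $f_i\in\mathbb{F}_q[x_1,\dots,x_n]$ is a permutation of $\mathbb{F}_q^n$ if for every $(u_1,\dots,u_n)\in\mathbb{F}_q^n$ the system $f_i(x_1,\dots,x_n)=u_i$ ($1\le i\le n$) has exactly one solution in $\mathbb{F}_q^n$. Two systems $F,G\in(\mathbb{F}_q[x_1,\dots,x_n])^n$ are linearly equivalent if $G=\rho\circ F\circ\sigma$ for nonsingular linear maps $\rho,\sigma:\mathbb{F}_q^n\to\mathbb{F}_q^n$. Two systems are coordinate shift (CS) equivalent if, for some $0\le k\le n$, one is $(f_1(x_1,\dots,x_k),\dots,f_k(x_1,\dots,x_k),x_{k+1},\dots,x_n)$ and the other is $(f_1(x_1,\dots,x_k),\dots,f_k(x_1,\dots,x_k),x_{k+1}+h_{k+1}(x_1,\dots,x_k),\dots,x_n+h_n(x_1,\dots,x_{n-1}))$ with each $h_i\in\mathbb{F}_q[x_1,\dots,x_{i-1}]$; systems differing only by a permutation (relabeling) of the variables/coordinates are regarded as the same for this purpose. $F\sim G$ means $F$ and $G$ are related by a finite sequence of linear equivalences and CS equivalences. *)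

theory Defs
  imports
    "HOL-Library.Poly_Mapping"
    "HOL-Computational_Algebra.Computational_Algebra"
    "HOL-Combinatorics.Permutations"
    "Jordan_Normal_Form.Matrix"
begin

text \<open>
  Formal multivariate polynomials are finitely supported maps from monomials (exponent
  vectors) to coefficients; \<open>+\<close>, \<open>*\<close>, \<open>^\<close> are those of \<open>Poly_Mapping\<close>.
  Formal polynomials are not identified with the functions they induce: over the field with
  two elements \<open>x\<close> and \<open>x\<^sup>2\<close> differ.
  Variables are indexed from 0, so the mathematical \<open>x\<^sub>1, \<dots>, x\<^sub>n\<close>
  are \<open>Var 0, \<dots>, Var (n - 1)\<close>.
\<close>

type_synonym 'a mpoly = "(nat \<Rightarrow>\<^sub>0 nat) \<Rightarrow>\<^sub>0 'a"

definition Var :: "nat \<Rightarrow> 'a::comm_ring_1 mpoly" where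
  "Var i = Poly_Mapping.single (Poly_Mapping.single i 1) 1"

definition Const :: "'a::comm_ring_1 \<Rightarrow> 'a mpoly" where
  "Const c = Poly_Mapping.single 0 c"

definition vars :: "'a::comm_ring_1 mpoly \<Rightarrow> nat set" where
  "vars f = (\<Union>m\<in>Poly_Mapping.keys f. Poly_Mapping.keys m)"

text \<open>The value of \<open>f\<close> when each coefficient \<open>c\<close> is replaced by \<open>h c\<close>
  and each variable \<open>x\<^sub>i\<close> by \<open>v i\<close>.\<close>

definition insertion_hom ::
    "('a::comm_ring_1 \<Rightarrow> 'b::comm_ring_1) \<Rightarrow> (nat \<Rightarrow> 'b) \<Rightarrow> 'a mpoly \<Rightarrow> 'b" where
  "insertion_hom h v f = (\<Sum>m\<in>Poly_Mapping.keys f. h (Poly_Mapping.lookup f m) * (\<Prod>i\<in>Poly_Mapping.keys m. v i ^ Poly_Mapping.lookup m i))"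

definition eval :: "(nat \<Rightarrow> 'a::comm_ring_1) \<Rightarrow> 'a mpoly \<Rightarrow> 'a" where
  "eval = insertion_hom (\<lambda>c. c)"

definition subst :: "(nat \<Rightarrow> 'a::comm_ring_1 mpoly) \<Rightarrow> 'a mpoly \<Rightarrow> 'a mpoly" where
  "subst = insertion_hom Const"

definition systems :: "nat \<Rightarrow> 'a::comm_ring_1 mpoly vec set" where
  "systems n = {F \<in> carrier_vec n. \<forall>i<n. vars (F $ i) \<subseteq> {..<n}}"

definition permutation_system :: "nat \<Rightarrow> 'a::comm_ring_1 mpoly vec \<Rightarrow> bool" where
  "permutation_system n F \<longleftrightarrow>
     (\<forall>u\<in>carrier_vec n. \<exists>!x. x \<in> carrier_vec n \<and> (\<forall>i<n. eval (\<lambda>j. x $ j) (F $ i) = u $ i))"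

text \<open>The composition of systems, first \<open>G\<close> and then \<open>F\<close>.\<close>

definition compose_sys :: "'a::comm_ring_1 mpoly vec \<Rightarrow> 'a mpoly vec \<Rightarrow> 'a mpoly vec" where
  "compose_sys F G = map_vec (subst (\<lambda>j. G $ j)) F"

definition linear_sys :: "nat \<Rightarrow> 'a::comm_ring_1 mat \<Rightarrow> 'a mpoly vec" where
  "linear_sys n A = vec n (\<lambda>i. \<Sum>j<n. Const (A $$ (i, j)) * Var j)"

definition linearly_equivalent ::
    "nat \<Rightarrow> 'a::comm_ring_1 mpoly vec \<Rightarrow> 'a mpoly vec \<Rightarrow> bool" where
  "linearly_equivalent n F G \<longleftrightarrow> F \<in> systems n \<and> G \<in> systems n \<and>
     (\<exists>R\<in>carrier_mat n n. \<exists>S\<in>carrier_mat n n. invertible_mat R \<and> invertible_mat S \<and>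
        G = compose_sys (linear_sys n R) (compose_sys F (linear_sys n S)))"

definition coordinate_shift ::
    "nat \<Rightarrow> 'a::comm_ring_1 mpoly vec \<Rightarrow> 'a mpoly vec \<Rightarrow> bool" where
  "coordinate_shift n F G \<longleftrightarrow> F \<in> systems n \<and> G \<in> systems n \<and>
     (\<exists>k\<le>n. (\<forall>i<k. vars (F $ i) \<subseteq> {..<k} \<and> G $ i = F $ i) \<and>
        (\<forall>i\<in>{k..<n}. F $ i = Var i \<and> (\<exists>h. vars h \<subseteq> {..<i} \<and> G $ i = Var i + h)))"

text \<open>Relabeling: the coordinates are reordered by \<open>\<pi>\<close> and the variables are
  renamed by \<open>\<tau>\<close>; the two permutations are independent of each other.\<close>

definition relabeling :: "nat \<Rightarrow> 'a::comm_ring_1 mpoly vec \<Rightarrow> 'a mpoly vec \<Rightarrow> bool" where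
  "relabeling n F G \<longleftrightarrow> F \<in> systems n \<and> G \<in> systems n \<and>
     (\<exists>\<pi> \<tau>. \<pi> permutes {..<n} \<and> \<tau> permutes {..<n} \<and>
        (\<forall>i<n. G $ i = subst (\<lambda>j. Var (\<tau> j)) (F $ \<pi> i)))"

definition CS_equivalent :: "nat \<Rightarrow> 'a::comm_ring_1 mpoly vec \<Rightarrow> 'a mpoly vec \<Rightarrow> bool" where
  "CS_equivalent n F G \<longleftrightarrow>
     (\<exists>F' G'. relabeling n F F' \<and> relabeling n G G' \<and>
        (coordinate_shift n F' G' \<or> coordinate_shift n G' F'))"

text \<open>Both kinds of steps are symmetric, so a directed chain suffices.\<close>

definition sys_equiv :: "nat \<Rightarrow> 'a::comm_ring_1 mpoly vec \<Rightarrow> 'a mpoly vec \<Rightarrow> bool" where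
  "sys_equiv n = (\<lambda>F G. linearly_equivalent n F G \<or> CS_equivalent n F G)\<^sup>*\<^sup>*"

definition permutation_poly :: "'a::comm_ring_1 poly \<Rightarrow> bool" where
  "permutation_poly f \<longleftrightarrow> bij (poly f)"

end

(* Both kinds of steps compose a system with bijections, so they preserve the permutation property.

   Conversely let F be a permutation. In odd characteristic, F(m + d) = F(m - d) is for fixed
   d a linear equation in m; as it has no solution for d \<noteq> 0, its determinant vanishes for all
   d, which makes the two quadratic parts proportional. In characteristic 2, a combination of the
   components without mixed term is additive and vanishes at some d \<noteq> 0; if a mixed term were
   present, one could solve F(z + d) = F(z). Hence there are no mixed terms.

   If the quadratic parts are proportional, F is equivalent to some (f, y), and injectivity of
   f(_, y) for every y leaves (x, y) and, in characteristic 2, (x^2, y). Otherwise the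
   characteristic is 2, F becomes (x^2, y^2) plus a linear map, and some combination of its
   components is the square of a linear form plus an independent linear form, unless the linear
   part is scalar, hence 0 by injectivity. *)
theory Submission
  imports Defs
begin

unbundle no fps_syntax

section \<open>Evaluation and substitution\<close>

lemma monom_prod_superset:
  fixes v :: "nat \<Rightarrow> 'b::comm_ring_1"
  assumes "finite A" "Poly_Mapping.keys m \<subseteq> A"
  shows "(\<Prod>i\<in>Poly_Mapping.keys m. v i ^ Poly_Mapping.lookup m i) = (\<Prod>i\<in>A. v i ^ Poly_Mapping.lookup m i)"
  using assms by (intro prod.mono_neutral_left) (auto simp: in_keys_iff)

lemma monom_prod_add:
  fixes v :: "nat \<Rightarrow> 'b::comm_ring_1"
  shows "(\<Prod>i\<in>Poly_Mapping.keys (m + m'). v i ^ Poly_Mapping.lookup (m + m') i) =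
    (\<Prod>i\<in>Poly_Mapping.keys m. v i ^ Poly_Mapping.lookup m i) *
    (\<Prod>i\<in>Poly_Mapping.keys m'. v i ^ Poly_Mapping.lookup m' i)"
proof -
  let ?A = "Poly_Mapping.keys m \<union> Poly_Mapping.keys m'"
  have "Poly_Mapping.keys (m + m') \<subseteq> ?A"
    by (rule keys_add)
  then have "(\<Prod>i\<in>Poly_Mapping.keys (m + m'). v i ^ Poly_Mapping.lookup (m + m') i) =
    (\<Prod>i\<in>?A. v i ^ Poly_Mapping.lookup (m + m') i)"
    by (intro monom_prod_superset) simp_all
  also have "\<dots> = (\<Prod>i\<in>?A. v i ^ Poly_Mapping.lookup m i) * (\<Prod>i\<in>?A. v i ^ Poly_Mapping.lookup m' i)"
    by (simp add: lookup_add power_add prod.distrib)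
  finally show ?thesis
    by (simp add: monom_prod_superset[of ?A])
qed

text \<open>Keys outside \<open>keys f\<close> have coefficient 0, which \<open>h\<close> kills.
  Cancellation can make the keys of \<open>f + g\<close> fewer than those of \<open>f\<close> and
  \<open>g\<close>, so additivity is proved by summing over a common index set.\<close>

lemma insertion_hom_superset:
  assumes "h 0 = 0" "finite A" "Poly_Mapping.keys f \<subseteq> A"
  shows "insertion_hom h v f = (\<Sum>m\<in>A. h (Poly_Mapping.lookup f m) * (\<Prod>i\<in>Poly_Mapping.keys m. v i ^ Poly_Mapping.lookup m i))"
  unfolding insertion_hom_def using assms
  by (intro sum.mono_neutral_left) (auto simp: in_keys_iff)

lemma insertion_hom_single:
  assumes "h 0 = 0"
  shows "insertion_hom h v (Poly_Mapping.single m c) = h c * (\<Prod>i\<in>Poly_Mapping.keys m. v i ^ Poly_Mapping.lookup m i)"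
  using assms by (simp add: insertion_hom_def)

lemma insertion_hom_add:
  assumes "comm_ring_hom h"
  shows "insertion_hom h v (f + g) = insertion_hom h v f + insertion_hom h v g"
proof -
  interpret comm_ring_hom h by fact
  let ?A = "Poly_Mapping.keys f \<union> Poly_Mapping.keys g"
  have "Poly_Mapping.keys (f + g) \<subseteq> ?A"
    by (rule keys_add)
  then show ?thesis
    by (simp add: insertion_hom_superset[of h ?A] lookup_add hom_add distrib_right sum.distrib)
qed

text \<open>Every polynomial is a sum of single terms, so a property closed under addition needs
  checking on terms only. This reduces multiplicativity to products of two terms.\<close>

lemma mpoly_induct [case_names single add]:
  fixes f :: "'a::comm_ring_1 mpoly"
  assumes single: "\<And>m c. P (Poly_Mapping.single m c)"
    and add: "\<And>f g. P f \<Longrightarrow> P g \<Longrightarrow> P (f + g)"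
  shows "P f"
proof (induction f rule: Poly_Mapping.update_induct)
  case const
  show ?case using single[of 0 0] by simp
next
  case (update f a b)
  \<comment> \<open>The updated key is fresh, so overwriting its coefficient 0 is the same as adding
    a term.\<close>
  have "Poly_Mapping.update a b f = f + Poly_Mapping.single a b"
    using update.hyps
    by (intro poly_mapping_eqI) (auto simp: lookup_update lookup_add lookup_single when_def in_keys_iff)
  then show ?case using add single update.IH by simp
qed

lemma insertion_hom_mult:
  assumes "comm_ring_hom h"
  shows "insertion_hom h v (f * g) = insertion_hom h v f * insertion_hom h v g"
proof -
  interpret comm_ring_hom h by fact
  show ?thesis
  proof (induction f rule: mpoly_induct)
    case (single m c)
    show ?case
    proof (induction g rule: mpoly_induct)
      case (single m' c')
      show ?case
        by (simp add: mult_single insertion_hom_single monom_prod_add hom_mult ac_simps)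
    next
      case (add f g)
      then show ?case by (simp add: insertion_hom_add[OF assms] distrib_left)
    qed
  next
    case (add f f')
    then show ?case by (simp add: insertion_hom_add[OF assms] distrib_right)
  qed
qed

lemma comm_ring_hom_insertion_hom:
  assumes "comm_ring_hom h"
  shows "comm_ring_hom (insertion_hom h v)"
proof -
  interpret comm_ring_hom h by fact
  have "insertion_hom h v 1 = 1"
    using insertion_hom_single[of h v 0 1] by (simp add: hom_one)
  moreover have "insertion_hom h v 0 = 0"
    by (simp add: insertion_hom_def)
  ultimately show ?thesis
    by unfold_locales (simp_all add: insertion_hom_add insertion_hom_mult assms)
qed

lemma comm_ring_hom_Const: "comm_ring_hom (Const :: 'a::comm_ring_1 \<Rightarrow> 'a mpoly)"
  by unfold_locales (simp_all add: Const_def single_add mult_single)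

lemma comm_ring_hom_eval: "comm_ring_hom (eval v)"
  unfolding eval_def by (rule comm_ring_hom_insertion_hom) (unfold_locales, simp_all)

lemma comm_ring_hom_subst: "comm_ring_hom (subst \<sigma>)"
  unfolding subst_def by (intro comm_ring_hom_insertion_hom comm_ring_hom_Const)

lemma Const_hom:
  "Const 0 = 0" "Const 1 = 1" "Const (numeral k) = numeral k"
  "Const (a + b) = Const a + Const b" "Const (a * b) = Const a * Const b"
proof -
  interpret comm_ring_hom Const by (rule comm_ring_hom_Const)
  show "Const 0 = 0" "Const 1 = 1" "Const (numeral k) = numeral k"
    "Const (a + b) = Const a + Const b" "Const (a * b) = Const a * Const b"
    by (simp_all only: hom_zero hom_one hom_numeral hom_add hom_mult)
qed

lemma eval_hom:
  "eval v (f + g) = eval v f + eval v g" "eval v (f * g) = eval v f * eval v g"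
  "eval v (f ^ n) = eval v f ^ n" "eval v (sum F A) = (\<Sum>x\<in>A. eval v (F x))"
  "eval v (prod F A) = (\<Prod>x\<in>A. eval v (F x))"
proof -
  interpret comm_ring_hom "eval v" by (rule comm_ring_hom_eval)
  show "eval v (f + g) = eval v f + eval v g" "eval v (f * g) = eval v f * eval v g"
    "eval v (f ^ n) = eval v f ^ n" "eval v (sum F A) = (\<Sum>x\<in>A. eval v (F x))"
    "eval v (prod F A) = (\<Prod>x\<in>A. eval v (F x))"
    by (simp_all only: hom_add hom_mult hom_power hom_sum hom_prod)
qed

lemma subst_hom:
  "subst \<sigma> (f + g) = subst \<sigma> f + subst \<sigma> g" "subst \<sigma> (f * g) = subst \<sigma> f * subst \<sigma> g"
  "subst \<sigma> (f ^ n) = subst \<sigma> f ^ n" "subst \<sigma> (sum F A) = (\<Sum>x\<in>A. subst \<sigma> (F x))"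
proof -
  interpret comm_ring_hom "subst \<sigma>" by (rule comm_ring_hom_subst)
  show "subst \<sigma> (f + g) = subst \<sigma> f + subst \<sigma> g" "subst \<sigma> (f * g) = subst \<sigma> f * subst \<sigma> g"
    "subst \<sigma> (f ^ n) = subst \<sigma> f ^ n" "subst \<sigma> (sum F A) = (\<Sum>x\<in>A. subst \<sigma> (F x))"
    by (simp_all only: hom_add hom_mult hom_power hom_sum)
qed

lemma insertion_hom_Const: "h 0 = 0 \<Longrightarrow> insertion_hom h v (Const c) = h c"
  by (simp add: Const_def insertion_hom_single)

lemma insertion_hom_Var: "h 0 = 0 \<Longrightarrow> h 1 = 1 \<Longrightarrow> insertion_hom h v (Var i) = v i"
  by (simp add: Var_def insertion_hom_single)

lemma eval_Const [simp]: "eval v (Const c) = c"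
  by (simp add: eval_def insertion_hom_Const)

lemma eval_Var [simp]: "eval v (Var i) = v i"
  by (simp add: eval_def insertion_hom_Var)

lemma subst_Const [simp]: "subst \<sigma> (Const c) = Const c"
  by (simp add: subst_def insertion_hom_Const Const_hom)

lemma subst_Var [simp]: "subst \<sigma> (Var i) = \<sigma> i"
  by (simp add: subst_def insertion_hom_Var Const_hom)

lemma insertion_hom_cong:
  assumes "\<And>i. i \<in> vars f \<Longrightarrow> v i = w i"
  shows "insertion_hom h v f = insertion_hom h w f"
  unfolding insertion_hom_def using assms
  by (intro sum.cong arg_cong2[where f="(*)"] prod.cong arg_cong2[where f="(^)"] refl) (auto simp: vars_def)

lemma eval_cong: "(\<And>i. i \<in> vars f \<Longrightarrow> v i = w i) \<Longrightarrow> eval v f = eval w f"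
  unfolding eval_def by (rule insertion_hom_cong)

text \<open>Evaluation is a ring homomorphism, so it passes through the sums and products that make
  up a substitution.\<close>

lemma eval_subst: "eval v (subst \<sigma> f) = eval (\<lambda>i. eval v (\<sigma> i)) f"
  unfolding subst_def insertion_hom_def
  by (simp add: eval_hom)
     (simp add: eval_def insertion_hom_def)

section \<open>Variables occurring in a polynomial\<close>

lemma vars_Const [simp]: "vars (Const c) = {}"
  by (auto simp: vars_def Const_def split: if_splits)

lemma vars_Var [simp]: "vars (Var i :: 'a::comm_ring_1 mpoly) = {i}"
  by (auto simp: vars_def Var_def)

lemma vars_add_subset: "vars f \<subseteq> A \<Longrightarrow> vars g \<subseteq> A \<Longrightarrow> vars (f + g) \<subseteq> A"
  using keys_add[of f g] unfolding vars_def by blast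

lemma vars_mult_subset: "vars f \<subseteq> A \<Longrightarrow> vars g \<subseteq> A \<Longrightarrow> vars (f * g) \<subseteq> A"
proof
  fix i assume A: "vars f \<subseteq> A" "vars g \<subseteq> A" and i: "i \<in> vars (f * g)"
  from i obtain m where m: "m \<in> Poly_Mapping.keys (f * g)" "i \<in> Poly_Mapping.keys m"
    by (auto simp: vars_def)
  from m(1) obtain a b where ab: "a \<in> Poly_Mapping.keys f" "b \<in> Poly_Mapping.keys g" "m = a + b"
    using keys_mult[of f g] by blast
  with m(2) have "i \<in> Poly_Mapping.keys a \<or> i \<in> Poly_Mapping.keys b"
    using keys_add[of a b] by blast
  with ab A show "i \<in> A" by (auto simp: vars_def)
qed

lemma vars_0 [simp]: "vars 0 = {}" and vars_1 [simp]: "vars 1 = {}"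
  by (simp_all add: vars_def)

lemma vars_power_subset: "vars f \<subseteq> A \<Longrightarrow> vars (f ^ n) \<subseteq> A"
  by (induction n) (simp_all add: vars_mult_subset)

lemma vars_sum_subset: "(\<And>i. i \<in> I \<Longrightarrow> vars (f i) \<subseteq> A) \<Longrightarrow> vars (\<Sum>i\<in>I. f i) \<subseteq> A"
  by (induction I rule: infinite_finite_induct) (simp_all add: vars_add_subset)

lemma vars_prod_subset: "(\<And>i. i \<in> I \<Longrightarrow> vars (f i) \<subseteq> A) \<Longrightarrow> vars (\<Prod>i\<in>I. f i) \<subseteq> A"
  by (induction I rule: infinite_finite_induct) (simp_all add: vars_mult_subset)

lemma vars_subst_subset:
  assumes "\<And>i. i \<in> vars f \<Longrightarrow> vars (\<sigma> i) \<subseteq> A"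
  shows "vars (subst \<sigma> f) \<subseteq> A"
proof -
  have "vars (\<sigma> i) \<subseteq> A" if "m \<in> Poly_Mapping.keys f" "i \<in> Poly_Mapping.keys m" for m i
    using assms[of i] that by (auto simp: vars_def[of f])
  then show ?thesis
    unfolding subst_def insertion_hom_def
    by (intro vars_sum_subset vars_mult_subset vars_prod_subset vars_power_subset) simp_all
qed

section \<open>Invariance of the permutation property\<close>

definition sys_fun :: "nat \<Rightarrow> 'a::comm_ring_1 mpoly vec \<Rightarrow> 'a vec \<Rightarrow> 'a vec" where
  "sys_fun n F x = vec n (\<lambda>i. eval (\<lambda>j. x $ j) (F $ i))"

lemma sys_fun_carrier [simp]: "sys_fun n F x \<in> carrier_vec n"
  by (simp add: sys_fun_def)

lemma bij_betw_iff_ex1: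
  assumes "\<And>x. x \<in> A \<Longrightarrow> f x \<in> B"
  shows "bij_betw f A B \<longleftrightarrow> (\<forall>u\<in>B. \<exists>!x. x \<in> A \<and> f x = u)"
proof
  assume bij: "bij_betw f A B"
  show "\<forall>u\<in>B. \<exists>!x. x \<in> A \<and> f x = u"
  proof
    fix u assume "u \<in> B"
    then obtain x where "x \<in> A" "u = f x"
      using bij_betw_imp_surj_on[OF bij] by blast
    then show "\<exists>!x. x \<in> A \<and> f x = u"
      using bij_betw_imp_inj_on[OF bij] by (intro ex1I[of _ x]) (auto dest: inj_onD)
  qed
next
  assume ex1: "\<forall>u\<in>B. \<exists>!x. x \<in> A \<and> f x = u"
  show "bij_betw f A B"
  proof (rule bij_betw_imageI)
    show "inj_on f A"
    proof (rule inj_onI)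
      fix x y assume "x \<in> A" "y \<in> A" "f x = f y"
      moreover from this have "\<exists>!z. z \<in> A \<and> f z = f y"
        using ex1 assms by simp
      ultimately show "x = y" by metis
    qed
    show "f ` A = B"
    proof (intro equalityI subsetI)
      fix u assume "u \<in> B"
      then obtain x where "x \<in> A" "f x = u"
        using ex1 by metis
      then show "u \<in> f ` A" by blast
    qed (use assms in blast)
  qed
qed

lemma permutation_system_iff_bij_betw:
  fixes F :: "'a::comm_ring_1 mpoly vec"
  shows "permutation_system n F \<longleftrightarrow> bij_betw (sys_fun n F) (carrier_vec n) (carrier_vec n)"
proof -
  have "(\<forall>i<n. eval (\<lambda>j. x $ j) (F $ i) = u $ i) \<longleftrightarrow> sys_fun n F x = u" if "u \<in> carrier_vec n" for u x
    using that by (auto simp: sys_fun_def vec_eq_iff)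
  then have "permutation_system n F \<longleftrightarrow> (\<forall>u\<in>carrier_vec n. \<exists>!x. x \<in> carrier_vec n \<and> sys_fun n F x = u)"
    by (simp add: permutation_system_def)
  also have "\<dots> \<longleftrightarrow> bij_betw (sys_fun n F) (carrier_vec n) (carrier_vec n)"
    by (rule bij_betw_iff_ex1[symmetric]) simp
  finally show ?thesis .
qed

text \<open>Entries of a vector beyond its dimension are unspecified; a system in \<open>n\<close>
  variables does not see them.\<close>

lemma eval_system_cong:
  fixes F :: "'a::comm_ring_1 mpoly vec"
  assumes "F \<in> systems n" "i < n" "\<And>j. j < n \<Longrightarrow> v j = w j"
  shows "eval v (F $ i) = eval w (F $ i)"
  using assms by (intro eval_cong) (auto simp: systems_def)

lemma sys_fun_compose:
  fixes F G :: "'a::comm_ring_1 mpoly vec"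
  assumes "F \<in> systems n"
  shows "sys_fun n (compose_sys F G) x = sys_fun n F (sys_fun n G x)"
proof (rule eq_vecI)
  fix i assume "i < dim_vec (sys_fun n F (sys_fun n G x))"
  then have i: "i < n"
    by (simp add: sys_fun_def)
  then have "compose_sys F G $ i = subst (\<lambda>j. G $ j) (F $ i)"
    using assms by (auto simp: compose_sys_def systems_def)
  moreover have "eval (\<lambda>j. eval (\<lambda>j. x $ j) (G $ j)) (F $ i) = eval (\<lambda>j. sys_fun n G x $ j) (F $ i)"
    by (rule eval_system_cong[OF assms i]) (simp add: sys_fun_def)
  ultimately show "sys_fun n (compose_sys F G) x $ i = sys_fun n F (sys_fun n G x) $ i"
    using i by (simp add: sys_fun_def eval_subst)
qed (simp add: sys_fun_def)

lemma compose_sys_in_systems: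
  fixes F G :: "'a::comm_ring_1 mpoly vec"
  assumes "F \<in> systems n" "G \<in> systems n"
  shows "compose_sys F G \<in> systems n"
proof -
  have "vars (compose_sys F G $ i) \<subseteq> {..<n}" if "i < n" for i
  proof -
    have eq: "compose_sys F G $ i = subst (\<lambda>j. G $ j) (F $ i)" and sub: "vars (F $ i) \<subseteq> {..<n}"
      using that assms(1) by (auto simp: compose_sys_def systems_def)
    show ?thesis
      unfolding eq
    proof (rule vars_subst_subset)
      fix j assume "j \<in> vars (F $ i)"
      with sub have "j < n" by auto
      then show "vars (G $ j) \<subseteq> {..<n}"
        using assms(2) by (simp add: systems_def)
    qed
  qed
  then show ?thesis
    using assms(1) by (simp add: systems_def compose_sys_def)
qed

lemma linear_sys_in_systems: "linear_sys n A \<in> systems n"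
proof -
  have "vars (\<Sum>j<n. Const (A $$ (i, j)) * Var j) \<subseteq> {..<n}" for i
    by (intro vars_sum_subset vars_mult_subset) auto
  then show ?thesis
    by (simp add: systems_def linear_sys_def)
qed

lemma sys_fun_linear_sys:
  assumes "A \<in> carrier_mat n n" "x \<in> carrier_vec n"
  shows "sys_fun n (linear_sys n A) x = A *\<^sub>v x"
  using assms
  by (auto simp: sys_fun_def linear_sys_def vec_eq_iff eval_hom scalar_prod_def atLeast0LessThan intro!: sum.cong)

lemma bij_betw_invertible_mat:
  fixes A :: "'a::comm_ring_1 mat"
  assumes A: "A \<in> carrier_mat n n" and "invertible_mat A"
  shows "bij_betw (\<lambda>x. A *\<^sub>v x) (carrier_vec n) (carrier_vec n)"
proof -
  obtain B where AB: "A * B = 1\<^sub>m (dim_row A)" and BA: "B * A = 1\<^sub>m (dim_row B)"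
    using assms(2) by (auto simp: invertible_mat_def inverts_mat_def)
  \<comment> \<open>Invertibility only provides some two-sided inverse \<open>B\<close>; its
    dimensions are read off from the column counts of the two products.\<close>
  have B: "B \<in> carrier_mat n n"
  proof
    show "dim_row B = n"
      using arg_cong[OF BA, of dim_col] A by simp
    show "dim_col B = n"
      using arg_cong[OF AB, of dim_col] A by simp
  qed
  have "A *\<^sub>v (B *\<^sub>v x) = x" "B *\<^sub>v (A *\<^sub>v x) = x" if "x \<in> carrier_vec n" for x
    unfolding assoc_mult_mat_vec[OF A B that, symmetric] assoc_mult_mat_vec[OF B A that, symmetric] AB BA
    using A B that by simp_all
  then show ?thesis
    using A B by (intro bij_betw_byWitness[where f' = "\<lambda>x. B *\<^sub>v x"]) auto
qed

text \<open>Composition with a bijection on either side neither creates nor destroys bijectivity.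
  Linear equivalences, relabelings and coordinate shifts are all brought into this form.\<close>

lemma permutation_system_sandwich:
  assumes "bij_betw P (carrier_vec n) (carrier_vec n)" "bij_betw Q (carrier_vec n) (carrier_vec n)"
    and "\<And>x. x \<in> carrier_vec n \<Longrightarrow> sys_fun n G x = P (sys_fun n F (Q x))"
  shows "permutation_system n F \<longleftrightarrow> permutation_system n G"
proof -
  let ?C = "carrier_vec n" let ?b = "\<lambda>f. bij_betw f ?C ?C"
  have "?b (sys_fun n G) \<longleftrightarrow> ?b (P \<circ> (sys_fun n F \<circ> Q))"
    using assms(3) by (intro bij_betw_cong) simp
  also have "\<dots> \<longleftrightarrow> ?b (sys_fun n F \<circ> Q)"
    by (rule bij_betw_comp_iff2[symmetric, OF assms(1)]) auto
  also have "\<dots> \<longleftrightarrow> ?b (sys_fun n F)"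
    by (rule bij_betw_comp_iff[symmetric, OF assms(2)])
  finally show ?thesis
    by (simp add: permutation_system_iff_bij_betw)
qed

lemma linearly_equivalent_permutation_system:
  assumes "linearly_equivalent n F G"
  shows "permutation_system n F \<longleftrightarrow> permutation_system n G"
proof -
  obtain R S where RS: "R \<in> carrier_mat n n" "S \<in> carrier_mat n n" "invertible_mat R" "invertible_mat S"
    and G: "G = compose_sys (linear_sys n R) (compose_sys F (linear_sys n S))" and F: "F \<in> systems n"
    using assms unfolding linearly_equivalent_def by blast
  show ?thesis
  proof (rule permutation_system_sandwich)
    show "bij_betw (\<lambda>x. R *\<^sub>v x) (carrier_vec n) (carrier_vec n)"
      "bij_betw (\<lambda>x. S *\<^sub>v x) (carrier_vec n) (carrier_vec n)"
      using RS by (auto intro: bij_betw_invertible_mat)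
    show "sys_fun n G x = R *\<^sub>v sys_fun n F (S *\<^sub>v x)" if "x \<in> carrier_vec n" for x
      using RS F that
      by (simp add: G sys_fun_compose linear_sys_in_systems sys_fun_linear_sys)
  qed
qed

text \<open>Only one composite of the two index maps is assumed to be the identity, so the lemma
  applies to a permutation and its inverse in either order.\<close>

lemma permute_vec_inverse:
  fixes a :: "'a vec"
  assumes "a \<in> carrier_vec n" "\<And>i. i < n \<Longrightarrow> \<sigma> i < n" "\<And>i. i < n \<Longrightarrow> \<pi> (\<sigma> i) = i"
  shows "vec n (\<lambda>i. vec n (\<lambda>i. a $ \<pi> i) $ \<sigma> i) = a"
proof (rule eq_vecI)
  fix i assume "i < dim_vec a"
  then have "i < n"
    using assms(1) by auto
  then show "vec n (\<lambda>i. vec n (\<lambda>i. a $ \<pi> i) $ \<sigma> i) $ i = a $ i"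
    using assms(2,3)[of i] by simp
qed (use assms(1) in simp)

lemma bij_betw_permute_vec:
  assumes "\<pi> permutes {..<n}"
  shows "bij_betw (\<lambda>x :: 'a vec. vec n (\<lambda>i. x $ \<pi> i)) (carrier_vec n) (carrier_vec n)"
proof (rule bij_betw_byWitness[where f' = "\<lambda>x :: 'a vec. vec n (\<lambda>i. x $ Hilbert_Choice.inv \<pi> i)"])
  have less: "\<pi> i < n" "Hilbert_Choice.inv \<pi> i < n" if "i < n" for i
    using permutes_in_image[OF assms, of i] permutes_in_image[OF permutes_inv[OF assms], of i] that
    unfolding lessThan_iff by blast+
  show "\<forall>a\<in>carrier_vec n. vec n (\<lambda>i. vec n (\<lambda>i. a $ \<pi> i) $ Hilbert_Choice.inv \<pi> i) = (a :: 'a vec)"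
    using less permutes_inverses(1)[OF assms] by (intro ballI permute_vec_inverse)
  show "\<forall>a\<in>carrier_vec n. vec n (\<lambda>i. vec n (\<lambda>i. a $ Hilbert_Choice.inv \<pi> i) $ \<pi> i) = (a :: 'a vec)"
    using less permutes_inverses(2)[OF assms] by (intro ballI permute_vec_inverse)
qed auto

text \<open>On values, renaming variables permutes the entries of the argument by
  \<open>\<tau>\<close>, and reordering coordinates permutes the entries of the result by
  \<open>\<pi>\<close>.\<close>

lemma relabeling_permutation_system:
  fixes F G :: "'a::comm_ring_1 mpoly vec"
  assumes "relabeling n F G"
  shows "permutation_system n F \<longleftrightarrow> permutation_system n G"
proof -
  obtain \<pi> \<tau> where p: "\<pi> permutes {..<n}" "\<tau> permutes {..<n}" and F: "F \<in> systems n"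
    and G: "\<forall>i<n. G $ i = subst (\<lambda>j. Var (\<tau> j)) (F $ \<pi> i)"
    using assms unfolding relabeling_def by blast
  have "\<pi> i < n" if "i < n" for i
    using permutes_in_image[OF p(1), of i] that unfolding lessThan_iff by blast
  then have "eval (\<lambda>j. x $ j) (G $ i) = sys_fun n F (vec n (\<lambda>i. x $ \<tau> i)) $ \<pi> i" if "i < n" for x :: "'a vec" and i
    using that eval_system_cong[OF F, of "\<pi> i" "\<lambda>j. x $ \<tau> j" "\<lambda>j. vec n (\<lambda>i. x $ \<tau> i) $ j"] G
    by (simp add: sys_fun_def eval_subst)
  then have "sys_fun n G x = vec n (\<lambda>i. sys_fun n F (vec n (\<lambda>i. x $ \<tau> i)) $ \<pi> i)" for x
    by (intro eq_vecI) (simp_all add: sys_fun_def[of n G])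
  then show ?thesis
    by (intro permutation_system_sandwich[OF bij_betw_permute_vec[OF p(1)] bij_betw_permute_vec[OF p(2)]])
qed

lemma finite_carrier_vec: "finite (carrier_vec n :: 'a::finite vec set)"
proof -
  have "carrier_vec n \<subseteq> vec_of_list ` {xs :: 'a list. set xs \<subseteq> UNIV \<and> length xs = n}"
  proof
    fix v :: "'a vec" assume "v \<in> carrier_vec n"
    then have "v = vec_of_list (list_of_vec v)" "length (list_of_vec v) = n"
      by (auto simp: vec_list)
    then show "v \<in> vec_of_list ` {xs :: 'a list. set xs \<subseteq> UNIV \<and> length xs = n}"
      by blast
  qed
  then show ?thesis
    by (rule finite_subset) (intro finite_imageI finite_lists_length_eq finite)
qed

text \<open>The shifted system is the original one after a triangular map \<open>T\<close> of the
  argument. Being injective on a finite set, \<open>T\<close> is bijective.\<close>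

lemma coordinate_shift_permutation_system:
  fixes F G :: "'a::{comm_ring_1,finite} mpoly vec"
  assumes "coordinate_shift n F G"
  shows "permutation_system n F \<longleftrightarrow> permutation_system n G"
proof -
  let ?C = "carrier_vec n :: 'a vec set"
  obtain k where k: "k \<le> n" "\<And>i. i < k \<Longrightarrow> vars (F $ i) \<subseteq> {..<k} \<and> G $ i = F $ i"
    and "\<forall>i\<in>{k..<n}. F $ i = Var i \<and> (\<exists>h. vars h \<subseteq> {..<i} \<and> G $ i = Var i + h)"
    using assms by (auto simp: coordinate_shift_def)
  then obtain h where h: "\<And>i. i \<in> {k..<n} \<Longrightarrow> F $ i = Var i \<and> vars (h i) \<subseteq> {..<i} \<and> G $ i = Var i + h i"
    by metis
  define T where "T x = vec n (\<lambda>i. if i < k then x $ i else x $ i + eval (\<lambda>j. x $ j) (h i))" for x :: "'a vec"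
  have "inj_on T ?C"
  proof (rule inj_onI)
    fix x y :: "'a vec" assume xy: "x \<in> ?C" "y \<in> ?C" "T x = T y"
    \<comment> \<open>Coordinates are recovered in increasing order: the shift \<open>h i\<close>
      depends only on coordinates below \<open>i\<close>, which already agree.\<close>
    have "x $ i = y $ i" if "i < n" for i
      using that
    proof (induction i rule: less_induct)
      case (less i)
      have "T x $ i = T y $ i"
        using xy by simp
      moreover have "eval (\<lambda>j. x $ j) (h i) = eval (\<lambda>j. y $ j) (h i)" if "k \<le> i"
        using h[of i] that less by (intro eval_cong less.IH) auto
      ultimately show ?case
        using less.prems by (cases "i < k") (auto simp: T_def)
    qed
    with xy show "x = y"
      by (auto simp: vec_eq_iff)
  qed
  then have T: "bij_betw T ?C ?C"
    by (intro bij_betw_imageI endo_inj_surj finite_carrier_vec) (auto simp: T_def)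
  have "sys_fun n G x $ i = sys_fun n F (T x) $ i" if "i < n" for x :: "'a vec" and i
  proof (cases "i < k")
    case True
    \<comment> \<open>The first \<open>k\<close> components use only variables that \<open>T\<close>
      leaves fixed; the remaining components of \<open>F\<close> are the bare variables, so there
      \<open>T\<close> itself produces the shift.\<close>
    then have "j < k \<and> j < n" if "j \<in> vars (F $ i)" for j
      using k(1) k(2)[of i] that by auto
    then have "eval (\<lambda>j. x $ j) (F $ i) = eval (\<lambda>j. T x $ j) (F $ i)"
      by (intro eval_cong) (simp add: T_def)
    with True that k show ?thesis by (simp add: sys_fun_def)
  next
    case False
    with that h[of i] show ?thesis by (simp add: sys_fun_def T_def eval_hom)
  qed
  then have "sys_fun n G x = id (sys_fun n F (T x))" for x
    by (intro eq_vecI) (simp_all add: sys_fun_def)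
  then show ?thesis
    by (intro permutation_system_sandwich[OF bij_betw_id T])
qed

lemma sys_equiv_permutation_system:
  fixes F G :: "'a::{comm_ring_1,finite} mpoly vec"
  assumes "sys_equiv n F G"
  shows "permutation_system n F \<longleftrightarrow> permutation_system n G"
  using assms unfolding sys_equiv_def
proof (induction rule: rtranclp_induct)
  case (step G H)
  have "permutation_system n G \<longleftrightarrow> permutation_system n H"
    using step.hyps(2)
  proof
    assume "CS_equivalent n G H"
    then obtain G' H' where "relabeling n G G'" "relabeling n H H'"
      "coordinate_shift n G' H' \<or> coordinate_shift n H' G'"
      unfolding CS_equivalent_def by blast
    then show ?thesis
      using relabeling_permutation_system[of n G G'] relabeling_permutation_system[of n H H']
        coordinate_shift_permutation_system[of n G' H'] coordinate_shift_permutation_system[of n H' G'] by argo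
  qed (rule linearly_equivalent_permutation_system)
  with step.IH show ?case by simp
qed simp

section \<open>Quadratic systems in two variables\<close>

definition quad :: "'a::comm_ring_1 \<Rightarrow> 'a \<Rightarrow> 'a \<Rightarrow> 'a \<Rightarrow> 'a \<Rightarrow> 'a mpoly" where
  "quad a b c d e = Const a * Var 0 ^ 2 + Const b * Var 0 * Var 1 + Const c * Var 1 ^ 2 + Const d * Var 0 + Const e * Var 1"

definition quad_sys :: "'a::comm_ring_1 \<Rightarrow> 'a \<Rightarrow> 'a \<Rightarrow> 'a \<Rightarrow> 'a \<Rightarrow> 'a \<Rightarrow> 'a \<Rightarrow> 'a \<Rightarrow> 'a \<Rightarrow> 'a \<Rightarrow> 'a mpoly vec" where
  "quad_sys a1 a2 a3 a4 a5 b1 b2 b3 b4 b5 = vec_of_list [quad a1 a2 a3 a4 a5, quad b1 b2 b3 b4 b5]"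

definition quad_val :: "'a::comm_ring_1 \<Rightarrow> 'a \<Rightarrow> 'a \<Rightarrow> 'a \<Rightarrow> 'a \<Rightarrow> 'a \<Rightarrow> 'a \<Rightarrow> 'a" where
  "quad_val a b c d e x y = a * x ^ 2 + b * x * y + c * y ^ 2 + d * x + e * y"

text \<open>Pairs replace vectors of length 2, so that bijectivity on a carrier set becomes
  bijectivity on a type.\<close>

definition quad_map :: "'a::comm_ring_1 \<Rightarrow> 'a \<Rightarrow> 'a \<Rightarrow> 'a \<Rightarrow> 'a \<Rightarrow> 'a \<Rightarrow> 'a \<Rightarrow> 'a \<Rightarrow> 'a \<Rightarrow> 'a \<Rightarrow> 'a \<times> 'a \<Rightarrow> 'a \<times> 'a" where
  "quad_map a1 a2 a3 a4 a5 b1 b2 b3 b4 b5 = (\<lambda>(x, y). (quad_val a1 a2 a3 a4 a5 x y, quad_val b1 b2 b3 b4 b5 x y))"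

lemma vars_quad: "vars (quad a b c d e) \<subseteq> {..<2}"
  unfolding quad_def by (intro vars_add_subset vars_mult_subset vars_power_subset) auto

lemma subst_quad:
  "subst \<sigma> (quad a b c d e) = Const a * \<sigma> 0 ^ 2 + Const b * \<sigma> 0 * \<sigma> 1 + Const c * \<sigma> 1 ^ 2 + Const d * \<sigma> 0 + Const e * \<sigma> 1"
  by (simp add: quad_def subst_hom)

lemma eval_quad:
  "eval v (quad a b c d e) = quad_val a b c d e (v 0) (v 1)"
  by (simp add: quad_def quad_val_def eval_hom)

lemma vec2_index [simp]:
  "vec_of_list [f, g] $ 0 = f" "vec_of_list [f, g] $ Suc 0 = g" "vec_of_list [f, g] $ 1 = g"
  by (simp_all only: vec_of_list_index) simp_all

lemma less_2_iff: "i < 2 \<longleftrightarrow> i = 0 \<or> i = Suc 0"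
  by auto

lemma vec2_eqI:
  fixes u w :: "'a vec"
  assumes "u \<in> carrier_vec 2" "w \<in> carrier_vec 2" "u $ 0 = w $ 0" "u $ 1 = w $ 1"
  shows "u = w"
  using assms by (intro eq_vecI) (auto simp: less_2_iff)

lemma vec2_carrier: "vec_of_list [f, g] \<in> carrier_vec 2"
  by (intro carrier_vecI) (simp only: dim_vec_of_list, simp)

lemma quad_sys_in_systems: "quad_sys a1 a2 a3 a4 a5 b1 b2 b3 b4 b5 \<in> systems 2"
proof -
  have "vars (quad_sys a1 a2 a3 a4 a5 b1 b2 b3 b4 b5 $ i) \<subseteq> {..<2}" if "i < 2" for i
    using that vars_quad by (cases "i = 0") (simp_all add: quad_sys_def less_2_iff del: vec_of_list_Cons)
  then show ?thesis
    by (simp add: systems_def quad_sys_def vec2_carrier del: vec_of_list_Cons)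
qed

text \<open>The bijection \<open>V\<close> from pairs to vectors of length 2 conjugates one map into
  the other.\<close>

lemma permutation_system_quad_sys:
  fixes a1 :: "'a::comm_ring_1"
  shows "permutation_system 2 (quad_sys a1 a2 a3 a4 a5 b1 b2 b3 b4 b5) \<longleftrightarrow> bij (quad_map a1 a2 a3 a4 a5 b1 b2 b3 b4 b5)"
    (is "permutation_system 2 ?F \<longleftrightarrow> bij ?q")
proof -
  define V :: "'a \<times> 'a \<Rightarrow> 'a vec" where "V = (\<lambda>(x, y). vec_of_list [x, y])"
  have V: "bij_betw V UNIV (carrier_vec 2)"
    by (intro bij_betw_byWitness[where f' = "\<lambda>u :: 'a vec. (u $ 0, u $ 1)"])
       (auto simp: V_def vec2_carrier simp del: vec_of_list_Cons intro!: vec2_eqI)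
  have "sys_fun 2 ?F (V p) = V (?q p)" for p
    by (intro vec2_eqI)
       (auto simp: V_def sys_fun_def quad_sys_def quad_map_def eval_quad vec2_carrier case_prod_unfold simp del: vec_of_list_Cons)
  then have "sys_fun 2 ?F \<circ> V = V \<circ> ?q"
    by auto
  then have "bij_betw (sys_fun 2 ?F) (carrier_vec 2) (carrier_vec 2) \<longleftrightarrow> bij_betw (V \<circ> ?q) UNIV (carrier_vec 2)"
    by (simp add: bij_betw_comp_iff[OF V])
  also have "\<dots> \<longleftrightarrow> bij ?q"
    by (rule bij_betw_comp_iff2[symmetric, OF V]) simp
  finally show ?thesis
    by (simp add: permutation_system_iff_bij_betw)
qed

section \<open>Invertible 2 x 2 matrices and the equivalences of quadratic systems\<close>

definition mat2 :: "'a \<Rightarrow> 'a \<Rightarrow> 'a \<Rightarrow> 'a \<Rightarrow> 'a mat" where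
  "mat2 r s t u = mat 2 2 (\<lambda>(i, j). if i = 0 then if j = 0 then r else s else if j = 0 then t else u)"

lemma mat2_carrier [simp]: "mat2 r s t u \<in> carrier_mat 2 2"
  by (simp add: mat2_def)

lemma mat2_mult:
  fixes r :: "'a::comm_ring_1"
  shows "mat2 r s t u * mat2 r' s' t' u' = mat2 (r * r' + s * t') (r * s' + s * u') (t * r' + u * t') (t * s' + u * u')"
  by (rule eq_matI) (auto simp: mat2_def scalar_prod_def less_2_iff numeral_2_eq_2)

lemma one_mat2: "1\<^sub>m 2 = mat2 1 0 0 (1 :: 'a::comm_ring_1)"
  by (rule eq_matI) (auto simp: mat2_def less_2_iff)

lemma invertible_mat2:
  fixes r :: "'a::field"
  assumes "r * u - s * t \<noteq> 0"
  shows "invertible_mat (mat2 r s t u)"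
proof -
  define E where "E = inverse (r * u - s * t)"
  \<comment> \<open>The adjugate divided by the determinant.\<close>
  let ?B = "mat2 (u * E) (- s * E) (- t * E) (r * E)"
  have "(r * u - s * t) * E = 1"
    using assms by (simp add: E_def)
  then have "mat2 r s t u * ?B = 1\<^sub>m 2" "?B * mat2 r s t u = 1\<^sub>m 2"
    unfolding mat2_mult one_mat2 by (simp_all add: algebra_simps)
  moreover have "dim_row (mat2 r s t u) = 2" "dim_col (mat2 r s t u) = 2" "dim_row ?B = 2"
    by (simp_all add: mat2_def)
  ultimately show ?thesis
    unfolding invertible_mat_def inverts_mat_def by auto
qed

lemma sum_lessThan_2: "(\<Sum>j<2::nat. f j) = f 0 + f 1"
  by (simp add: numeral_2_eq_2)

lemma linear_sys_mat2:
  "linear_sys 2 (mat2 r s t u) = vec_of_list [Const r * Var 0 + Const s * Var 1, Const t * Var 0 + Const u * Var 1]"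
  by (intro vec2_eqI)
     (simp_all add: linear_sys_def mat2_def vec2_carrier sum_lessThan_2 del: vec_of_list_Cons)

lemma compose_sys_vec2:
  "compose_sys (vec_of_list [f, g]) H = vec_of_list [subst (\<lambda>j. H $ j) f, subst (\<lambda>j. H $ j) g]"
  by (simp only: compose_sys_def vec_of_list_map[symmetric] list.map)

lemma linearly_equivalent_vec2:
  fixes f g :: "'a::field mpoly"
  assumes "vec_of_list [f, g] \<in> systems 2" "r * u - s * t \<noteq> 0" "invertible_mat S" "S \<in> carrier_mat 2 2"
    and "f' = subst (\<lambda>j. linear_sys 2 S $ j) f" "g' = subst (\<lambda>j. linear_sys 2 S $ j) g"
  shows "linearly_equivalent 2 (vec_of_list [f, g])
    (vec_of_list [Const r * f' + Const s * g', Const t * f' + Const u * g'])"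
proof -
  have eq: "vec_of_list [Const r * f' + Const s * g', Const t * f' + Const u * g'] =
      compose_sys (linear_sys 2 (mat2 r s t u)) (compose_sys (vec_of_list [f, g]) (linear_sys 2 S))"
    by (simp add: compose_sys_vec2 linear_sys_mat2 subst_hom assms(5,6) del: vec_of_list_Cons)
  show ?thesis
    unfolding linearly_equivalent_def eq
    by (intro conjI bexI[of _ "mat2 r s t u"] bexI[of _ S] compose_sys_in_systems linear_sys_in_systems
        refl assms invertible_mat2 mat2_carrier)
qed

text \<open>Expansion at (r x + s y, t x + u y). The squares contribute to the mixed term only with
  a factor 2, so in characteristic 2 a linear change of variables creates no mixed term.\<close>

lemma subst_linear_quad:
  "subst (\<lambda>j. linear_sys 2 (mat2 r s t u) $ j) (quad a b c d e) =
    quad (a * r^2 + b * r * t + c * t^2) (2 * a * r * s + b * (r * u + s * t) + 2 * c * t * u)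
      (a * s^2 + b * s * u + c * u^2) (d * r + e * t) (d * s + e * u)"
  unfolding subst_quad linear_sys_mat2 vec2_index
  unfolding quad_def power2_eq_square Const_hom mult_2
  by (simp only: algebra_simps)

lemma linear_combination_quad:
  "Const r * quad a1 a2 a3 a4 a5 + Const s * quad b1 b2 b3 b4 b5 =
    quad (r * a1 + s * b1) (r * a2 + s * b2) (r * a3 + s * b3) (r * a4 + s * b4) (r * a5 + s * b5)"
  by (simp add: quad_def Const_hom algebra_simps)

text \<open>A linear change of the outputs: the rows (r, s) and (t, u) combine the two components.
  The new coefficients enter through equations, so that a target can be given in simplified
  form.\<close>

lemma sys_equiv_quad_sys_left:
  fixes a1 :: "'a::field"
  assumes "r * u - s * t \<noteq> 0"
    and "c1 = r * a1 + s * b1" "c2 = r * a2 + s * b2" "c3 = r * a3 + s * b3" "c4 = r * a4 + s * b4" "c5 = r * a5 + s * b5"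
    and "d1 = t * a1 + u * b1" "d2 = t * a2 + u * b2" "d3 = t * a3 + u * b3" "d4 = t * a4 + u * b4" "d5 = t * a5 + u * b5"
  shows "sys_equiv 2 (quad_sys a1 a2 a3 a4 a5 b1 b2 b3 b4 b5) (quad_sys c1 c2 c3 c4 c5 d1 d2 d3 d4 d5)"
proof -
  let ?I = "mat2 1 0 0 (1 :: 'a)"
  have subst: "quad a b c d e = subst (\<lambda>j. linear_sys 2 ?I $ j) (quad a b c d e)" for a b c d e
    by (simp add: subst_linear_quad)
  have "linearly_equivalent 2 (quad_sys a1 a2 a3 a4 a5 b1 b2 b3 b4 b5) (quad_sys c1 c2 c3 c4 c5 d1 d2 d3 d4 d5)"
    using linearly_equivalent_vec2[OF quad_sys_in_systems[unfolded quad_sys_def] assms(1) _ mat2_carrier subst subst]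
    by (simp add: quad_sys_def assms(2-) invertible_mat2 linear_combination_quad del: vec_of_list_Cons)
  then show ?thesis
    by (simp add: sys_equiv_def r_into_rtranclp)
qed

text \<open>The linear change of variables x := r x + s y, y := t x + u y, with the identity on the
  outputs.\<close>

lemma sys_equiv_quad_sys_right:
  fixes a1 :: "'a::field"
  assumes "r * u - s * t \<noteq> 0"
    and "c1 = a1 * r^2 + a2 * r * t + a3 * t^2" "c2 = 2 * a1 * r * s + a2 * (r * u + s * t) + 2 * a3 * t * u"
      "c3 = a1 * s^2 + a2 * s * u + a3 * u^2" "c4 = a4 * r + a5 * t" "c5 = a4 * s + a5 * u"
    and "d1 = b1 * r^2 + b2 * r * t + b3 * t^2" "d2 = 2 * b1 * r * s + b2 * (r * u + s * t) + 2 * b3 * t * u"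
      "d3 = b1 * s^2 + b2 * s * u + b3 * u^2" "d4 = b4 * r + b5 * t" "d5 = b4 * s + b5 * u"
  shows "sys_equiv 2 (quad_sys a1 a2 a3 a4 a5 b1 b2 b3 b4 b5) (quad_sys c1 c2 c3 c4 c5 d1 d2 d3 d4 d5)"
proof -
  have unit: "Const 1 * f + Const 0 * g = f" "Const 0 * f + Const 1 * g = g" for f g :: "'a mpoly"
    by (simp_all add: Const_hom)
  have "linearly_equivalent 2 (quad_sys a1 a2 a3 a4 a5 b1 b2 b3 b4 b5) (quad_sys c1 c2 c3 c4 c5 d1 d2 d3 d4 d5)"
    unfolding quad_sys_def assms(2-)
    by (rule linearly_equivalent_vec2[OF quad_sys_in_systems[unfolded quad_sys_def] _ invertible_mat2[OF assms(1)]
        mat2_carrier subst_linear_quad[symmetric] subst_linear_quad[symmetric], of 1 1 0 0, unfolded unit]) simp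
  then show ?thesis
    by (simp add: sys_equiv_def r_into_rtranclp)
qed

lemma relabeling_quad_sys_refl:
  fixes a1 :: "'a::comm_ring_1"
  shows "relabeling 2 (quad_sys a1 a2 a3 a4 a5 b1 b2 b3 b4 b5) (quad_sys a1 a2 a3 a4 a5 b1 b2 b3 b4 b5)"
proof -
  have "subst (\<lambda>j. Var (id j)) (quad a b c d e) = quad a b c d e" for a b c d e :: 'a
    unfolding subst_quad unfolding quad_def by simp
  then have "quad_sys a1 a2 a3 a4 a5 b1 b2 b3 b4 b5 $ i =
      subst (\<lambda>j. Var (id j)) (quad_sys a1 a2 a3 a4 a5 b1 b2 b3 b4 b5 $ id i)" if "i < 2" for i
    using that by (cases "i = 0") (simp_all add: quad_sys_def less_2_iff del: vec_of_list_Cons)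
  then show ?thesis
    unfolding relabeling_def
    by (intro conjI quad_sys_in_systems exI[of _ id]) (simp_all add: permutes_id)
qed

text \<open>The only proper coordinate shift in the classification; all other reductions below are
  linear equivalences.\<close>

lemma sys_equiv_quad_sys_shift:
  "sys_equiv 2 (quad_sys 0 0 0 1 0 c 0 0 d (1 :: 'a::comm_ring_1)) (quad_sys 0 0 0 1 0 0 0 0 0 1)"
    (is "sys_equiv 2 ?G ?F")
proof -
  have "coordinate_shift 2 ?F ?G"
    unfolding coordinate_shift_def
  \<comment> \<open>With \<open>k = 0\<close> both coordinates count as shifted: the first by 0, the
    second by c x^2 + d x.\<close>
  proof (intro conjI quad_sys_in_systems exI[of _ 0])
    have "\<exists>h. vars h \<subseteq> {..<i} \<and> ?G $ i = Var i + h" if "i < 2" for i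
    proof (cases "i = 0")
      case True
      then show ?thesis
        by (intro exI[of _ 0]) (simp add: quad_sys_def quad_def Const_hom del: vec_of_list_Cons)
    next
      case False
      have "vars (Const c * Var 0 ^ 2 + Const d * Var 0) \<subseteq> {..<1}"
        by (intro vars_add_subset vars_mult_subset vars_power_subset) auto
      with False that show ?thesis
        by (intro exI[of _ "Const c * Var 0 ^ 2 + Const d * Var 0"])
           (auto simp: less_2_iff quad_sys_def quad_def Const_hom simp del: vec_of_list_Cons)
    qed
    then show "\<forall>i\<in>{0..<2}. ?F $ i = Var i \<and> (\<exists>h. vars h \<subseteq> {..<i} \<and> ?G $ i = Var i + h)"
      by (auto simp: less_2_iff quad_sys_def[of 0 0 0 1 0 0] quad_def[of 0 0 0] Const_hom simp del: vec_of_list_Cons)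
  qed auto
  then show ?thesis
    unfolding sys_equiv_def CS_equivalent_def using relabeling_quad_sys_refl by blast
qed

lemma sys_equiv_trans [trans]: "sys_equiv n F G \<Longrightarrow> sys_equiv n G H \<Longrightarrow> sys_equiv n F H"
  unfolding sys_equiv_def by (rule rtranclp_trans)

section \<open>Proportional quadratic parts\<close>

text \<open>Possible collisions are 0 and 1 if a = k = 0, the two roots 0 and -k/a if a is nonzero,
  and 1 and -1 if k = 0.\<close>

lemma inj_quadratic:
  fixes a k :: "'a::field"
  assumes "inj (\<lambda>x. a * x ^ 2 + k * x)"
  shows "a = 0 \<and> k \<noteq> 0 \<or> a \<noteq> 0 \<and> k = 0 \<and> (2 :: 'a) = 0"
proof -
  have "k \<noteq> 0" if "a = 0"
    using injD[OF assms, of 0 1] that by auto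
  moreover have "k = 0" if "a \<noteq> 0"
  proof -
    have "a * (- k / a) ^ 2 + k * (- k / a) = 0"
      using that by (simp add: power2_eq_square)
    then have "- k / a = 0"
      using injD[OF assms, of "- k / a" 0] by simp
    with that show ?thesis by simp
  qed
  moreover have "(2 :: 'a) = 0" if "k = 0"
  proof -
    have "(1 :: 'a) = - 1"
      using injD[OF assms, of 1 "- 1"] that by simp
    then have "1 + 1 = (0 :: 'a)"
      by (simp add: eq_neg_iff_add_eq_0)
    then show ?thesis by simp
  qed
  ultimately show ?thesis by blast
qed

text \<open>The second component is y, so the first must be injective in x for each fixed y. Up to a
  constant it is a x^2 + (b y + d) x.\<close>

lemma inj_quad_map_snd:
  fixes a :: "'a::field"
  assumes inj: "inj (quad_map a b c d e 0 0 0 0 1)"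
  shows "b = 0 \<and> (a = 0 \<and> d \<noteq> 0 \<or> a \<noteq> 0 \<and> d = 0 \<and> (2 :: 'a) = 0)"
proof -
  have *: "a = 0 \<and> b * y + d \<noteq> 0 \<or> a \<noteq> 0 \<and> b * y + d = 0 \<and> (2 :: 'a) = 0" for y
  proof (rule inj_quadratic, rule injI)
    fix x x' assume "a * x ^ 2 + (b * y + d) * x = a * x' ^ 2 + (b * y + d) * x'"
    then have "quad_map a b c d e 0 0 0 0 1 (x, y) = quad_map a b c d e 0 0 0 0 1 (x', y)"
      by (simp add: quad_map_def quad_val_def algebra_simps)
    from injD[OF inj this] show "x = x'" by simp
  qed
  have "b = 0"
  proof (cases "a = 0")
    case True
    show ?thesis
    proof (rule ccontr)
      \<comment> \<open>At y = -d/b the linear coefficient vanishes and the slice is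
        constant.\<close>
      assume "b \<noteq> 0"
      then show False using *[of "- d / b"] True by simp
    qed
  next
    case False
    \<comment> \<open>Both linear coefficients d and b + d vanish.\<close>
    with *[of 0] *[of 1] show ?thesis by simp
  qed
  with *[of 0] show ?thesis by simp
qed

text \<open>Squaring is the Frobenius map, which is additive with trivial kernel.\<close>

lemma char2_inj_square:
  assumes "(2 :: 'a::field) = 0"
  shows "inj (\<lambda>s :: 'a. s ^ 2)"
proof (rule injI)
  fix s t :: 'a assume "s ^ 2 = t ^ 2"
  moreover have "(s - t) ^ 2 = s ^ 2 - t ^ 2 - 2 * t * (s - t)"
    by (simp add: power2_eq_square algebra_simps)
  ultimately have "(s - t) ^ 2 = 0"
    by (simp add: assms)
  then show "s = t" by simp
qed

lemma char2_square_surj: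
  fixes c :: "'a::{field,finite}"
  assumes "(2 :: 'a) = 0"
  obtains s :: 'a where "s ^ 2 = c"
  using finite_UNIV_inj_surj[OF finite_UNIV char2_inj_square[OF assms]] by (metis surjD)

lemma char2_uminus:
  fixes x :: "'a::comm_ring_1"
  assumes "(2 :: 'a) = 0"
  shows "- x = x"
proof -
  have "x + x = 0" using assms by (simp flip: mult_2)
  then show ?thesis by (simp add: eq_neg_iff_add_eq_0)
qed

text \<open>Components and variables are exchanged together, so facts about the first component
  carry over to the second and the diagonal shape is kept.\<close>

lemma sys_equiv_swap:
  fixes a1 :: "'a::field"
  shows "sys_equiv 2 (quad_sys a1 a2 a3 a4 a5 b1 b2 b3 b4 b5) (quad_sys b3 b2 b1 b5 b4 a3 a2 a1 a5 a4)"
proof (rule sys_equiv_trans)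
  show "sys_equiv 2 (quad_sys a1 a2 a3 a4 a5 b1 b2 b3 b4 b5) (quad_sys b1 b2 b3 b4 b5 a1 a2 a3 a4 a5)"
    by (rule sys_equiv_quad_sys_left[where r = 0 and s = 1 and t = 1 and u = 0]) simp_all
  show "sys_equiv 2 (quad_sys b1 b2 b3 b4 b5 a1 a2 a3 a4 a5) (quad_sys b3 b2 b1 b5 b4 a3 a2 a1 a5 a4)"
    by (rule sys_equiv_quad_sys_right[where r = 0 and s = 1 and t = 1 and u = 0]) simp_all
qed

text \<open>Dividing by d gives (x + h(y), y). The swap moves the polynomial h to the second
  coordinate, where a coordinate shift removes it.\<close>

lemma sys_equiv_triangular:
  fixes d :: "'a::field"
  assumes "d \<noteq> 0"
  shows "sys_equiv 2 (quad_sys 0 0 c d e 0 0 0 0 1) (quad_sys 0 0 0 1 0 0 0 0 0 1)"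
proof -
  have "sys_equiv 2 (quad_sys 0 0 c d e 0 0 0 0 1) (quad_sys 0 0 (c / d) 1 (e / d) 0 0 0 0 1)"
    by (rule sys_equiv_quad_sys_left[where r = "1 / d" and s = 0 and t = 0 and u = 1]) (use assms in simp_all)
  also note sys_equiv_swap
  also note sys_equiv_quad_sys_shift
  finally (sys_equiv_trans) show ?thesis .
qed

lemma sys_equiv_squared:
  fixes a :: "'a::{field,finite}"
  assumes "a \<noteq> 0" and two: "(2 :: 'a) = 0"
  shows "sys_equiv 2 (quad_sys a 0 c 0 e 0 0 0 0 1) (quad_sys 1 0 0 0 0 0 0 0 0 1)"
proof -
  obtain s where s: "s ^ 2 = c / a"
    using char2_square_surj[OF two] .
  \<comment> \<open>The second component is y, so a multiple of it cancels the term in y.\<close>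
  have "sys_equiv 2 (quad_sys a 0 c 0 e 0 0 0 0 1) (quad_sys 1 0 (c / a) 0 0 0 0 0 0 1)"
    by (rule sys_equiv_quad_sys_left[where r = "1 / a" and s = "- e / a" and t = 0 and u = 1])
       (use assms in \<open>simp_all add: field_simps\<close>)
  \<comment> \<open>Here x^2 + (c/a) y^2 = (x + s y)^2, and replacing x by x + s y turns it into
    x^2, since 2 s = 0.\<close>
  also have "sys_equiv 2 (quad_sys 1 0 (c / a) 0 0 0 0 0 0 1) (quad_sys 1 0 0 0 0 0 0 0 0 (1 :: 'a))"
  proof (rule sys_equiv_quad_sys_right[where r = 1 and s = s and t = 0 and u = 1])
    have "c / a + c / a = 0"
      using two by (simp flip: mult_2)
    then show "0 = 1 * s ^ 2 + 0 * s * 1 + c / a * 1 ^ 2"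
      by (simp add: s)
  qed (use two in simp_all)
  finally (sys_equiv_trans) show ?thesis .
qed

text \<open>Surjectivity makes the linear second component nonzero, so it can serve as the new
  variable y. Injectivity in x then fixes the shape of the first component.\<close>

lemma permutation_second_linear:
  fixes a1 :: "'a::{field,finite}"
  assumes perm: "permutation_system 2 (quad_sys a1 a2 a3 a4 a5 0 0 0 b4 b5)"
  shows "sys_equiv 2 (quad_sys a1 a2 a3 a4 a5 0 0 0 b4 b5) (quad_sys 0 0 0 1 0 0 0 0 0 1) \<or>
    (2 :: 'a) = 0 \<and> sys_equiv 2 (quad_sys a1 a2 a3 a4 a5 0 0 0 b4 b5) (quad_sys 1 0 0 0 0 0 0 0 0 1)"
proof -
  let ?F = "quad_sys a1 a2 a3 a4 a5 0 0 0 b4 b5"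
  have "\<exists>a b c d e. sys_equiv 2 ?F (quad_sys a b c d e 0 0 0 0 1)"
  proof (cases "b5 = 0")
    case False
    then show ?thesis
      by (intro exI, intro sys_equiv_quad_sys_right[where r = 1 and s = 0 and t = "- b4 / b5" and u = "1 / b5"] refl) simp_all
  next
    case True
    have "b4 \<noteq> 0"
    proof
      assume "b4 = 0"
      moreover have "surj (quad_map a1 a2 a3 a4 a5 0 0 0 b4 b5)"
        using perm by (simp add: permutation_system_quad_sys bij_is_surj)
      then obtain p where "quad_map a1 a2 a3 a4 a5 0 0 0 b4 b5 p = (0, 1)"
        by (metis surjD)
      ultimately show False
        using True by (simp add: quad_map_def quad_val_def case_prod_unfold)
    qed
    with True show ?thesis
      by (intro exI, intro sys_equiv_quad_sys_right[where r = 0 and s = "1 / b4" and t = 1 and u = 0] refl) simp_all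
  qed
  then obtain a b c d e where equiv: "sys_equiv 2 ?F (quad_sys a b c d e 0 0 0 0 1)"
    by blast
  then have "permutation_system 2 (quad_sys a b c d e 0 0 0 0 1)"
    using perm sys_equiv_permutation_system by blast
  then have "inj (quad_map a b c d e 0 0 0 0 1)"
    by (simp add: permutation_system_quad_sys bij_is_inj)
  from inj_quad_map_snd[OF this] show ?thesis
    using equiv sys_equiv_triangular[of d c e] sys_equiv_squared[of a c e] sys_equiv_trans by blast
qed

text \<open>The vanishing minors say that the quadratic coefficients have rank at most 1. An
  invertible change of outputs therefore makes the second component linear.\<close>

lemma permutation_proportional:
  fixes a1 :: "'a::{field,finite}"
  assumes perm: "permutation_system 2 (quad_sys a1 a2 a3 a4 a5 b1 b2 b3 b4 b5)"
    and minors: "a1 * b2 = a2 * b1" "a1 * b3 = a3 * b1" "a2 * b3 = a3 * b2"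
  shows "sys_equiv 2 (quad_sys a1 a2 a3 a4 a5 b1 b2 b3 b4 b5) (quad_sys 0 0 0 1 0 0 0 0 0 1) \<or>
    (2 :: 'a) = 0 \<and> sys_equiv 2 (quad_sys a1 a2 a3 a4 a5 b1 b2 b3 b4 b5) (quad_sys 1 0 0 0 0 0 0 0 0 1)"
proof -
  let ?F = "quad_sys a1 a2 a3 a4 a5 b1 b2 b3 b4 b5"
  have "\<exists>r s t u. r * u - s * t \<noteq> 0 \<and> t * a1 + u * b1 = 0 \<and> t * a2 + u * b2 = 0 \<and> t * a3 + u * b3 = 0"
  proof -
    consider "a1 = 0" "a2 = 0" "a3 = 0" | "a1 \<noteq> 0" | "a2 \<noteq> 0" | "a3 \<noteq> 0" by blast
    then show ?thesis
    proof cases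
      case 1
      then show ?thesis by (intro exI[of _ 0] exI[of _ 1] exI[of _ 1] exI[of _ 0]) simp
    next
      \<comment> \<open>A nonzero quadratic coefficient of the first component is the pivot of the
        elimination and equals the determinant r u - s t; the next two cases are analogous.\<close>
      case 2
      then show ?thesis using minors
        by (intro exI[of _ 1] exI[of _ 0] exI[of _ "- b1"] exI[of _ a1]) (simp add: algebra_simps)
    next
      case 3
      then show ?thesis using minors
        by (intro exI[of _ 1] exI[of _ 0] exI[of _ "- b2"] exI[of _ a2]) (simp add: algebra_simps)
    next
      case 4
      then show ?thesis using minors
        by (intro exI[of _ 1] exI[of _ 0] exI[of _ "- b3"] exI[of _ a3]) (simp add: algebra_simps)
    qed
  qed
  then obtain r s t u where D: "r * u - s * t \<noteq> 0"
    and z: "0 = t * a1 + u * b1" "0 = t * a2 + u * b2" "0 = t * a3 + u * b3"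
    by metis
  let ?G = "quad_sys (r * a1 + s * b1) (r * a2 + s * b2) (r * a3 + s * b3) (r * a4 + s * b4) (r * a5 + s * b5)
      0 0 0 (t * a4 + u * b4) (t * a5 + u * b5)"
  have equiv: "sys_equiv 2 ?F ?G"
    by (rule sys_equiv_quad_sys_left[OF D refl refl refl refl refl z refl refl])
  then have "permutation_system 2 ?G"
    using perm sys_equiv_permutation_system by blast
  from permutation_second_linear[OF this] equiv show ?thesis
    using sys_equiv_trans by blast
qed

section \<open>Odd characteristic and characteristic 2\<close>

lemma cramer2:
  fixes A1 :: "'a::field"
  assumes "A1 * B2 - A2 * B1 \<noteq> 0"
  obtains m1 m2 where "A1 * m1 + A2 * m2 = p" "B1 * m1 + B2 * m2 = q"
proof
  let ?D = "A1 * B2 - A2 * B1"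
  have "A1 * ((p * B2 - q * A2) / ?D) + A2 * ((A1 * q - B1 * p) / ?D) = (p * ?D) / ?D"
    unfolding times_divide_eq_right add_divide_distrib[symmetric] by (simp add: algebra_simps)
  then show "A1 * ((p * B2 - q * A2) / ?D) + A2 * ((A1 * q - B1 * p) / ?D) = p"
    using assms by simp
  have "B1 * ((p * B2 - q * A2) / ?D) + B2 * ((A1 * q - B1 * p) / ?D) = (q * ?D) / ?D"
    unfolding times_divide_eq_right add_divide_distrib[symmetric] by (simp add: algebra_simps)
  then show "B1 * ((p * B2 - q * A2) / ?D) + B2 * ((A1 * q - B1 * p) / ?D) = q"
    using assms by simp
qed

text \<open>In a difference symmetric about m the pure squares cancel; what remains is affine in m,
  with the polar form of the quadratic part as its linear part.\<close>

lemma quad_val_symmetric_difference: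
  "quad_val a b c d e (m1 + x) (m2 + y) - quad_val a b c d e (m1 - x) (m2 - y) =
    2 * ((2 * a * x + b * y) * m1 + (b * x + 2 * c * y) * m2 + (d * x + e * y))"
  by (simp add: quad_val_def power2_eq_square algebra_simps)

text \<open>Otherwise Cramer's rule yields a midpoint m with equal values at m + (x, y) and m - (x,
  y), two distinct points because 2 is nonzero.\<close>

lemma odd_char_determinant:
  fixes a1 :: "'a::field"
  assumes two: "(2 :: 'a) \<noteq> 0" and inj: "inj (quad_map a1 a2 a3 a4 a5 b1 b2 b3 b4 b5)" and "(x, y) \<noteq> (0, 0)"
  shows "(2 * a1 * x + a2 * y) * (b2 * x + 2 * b3 * y) - (a2 * x + 2 * a3 * y) * (2 * b1 * x + b2 * y) = 0"
proof (rule ccontr)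
  assume "\<not> ?thesis"
  from cramer2[OF this] obtain m1 m2
    where m: "(2 * a1 * x + a2 * y) * m1 + (a2 * x + 2 * a3 * y) * m2 = - (a4 * x + a5 * y)"
      "(2 * b1 * x + b2 * y) * m1 + (b2 * x + 2 * b3 * y) * m2 = - (b4 * x + b5 * y)" .
  have "quad_val a1 a2 a3 a4 a5 (m1 + x) (m2 + y) - quad_val a1 a2 a3 a4 a5 (m1 - x) (m2 - y) = 0"
    "quad_val b1 b2 b3 b4 b5 (m1 + x) (m2 + y) - quad_val b1 b2 b3 b4 b5 (m1 - x) (m2 - y) = 0"
    unfolding quad_val_symmetric_difference m by simp_all
  then have "quad_map a1 a2 a3 a4 a5 b1 b2 b3 b4 b5 (m1 + x, m2 + y) = quad_map a1 a2 a3 a4 a5 b1 b2 b3 b4 b5 (m1 - x, m2 - y)"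
    by (simp add: quad_map_def)
  from injD[OF inj this] have "(m1 + x) - (m1 - x) = 0" "(m2 + y) - (m2 - y) = 0"
    by simp_all
  moreover have "(m1 + x) - (m1 - x) = 2 * x" "(m2 + y) - (m2 - y) = 2 * y"
    by (simp_all add: algebra_simps)
  ultimately have "2 * x = 0" "2 * y = 0"
    by simp_all
  with two assms(3) show False by simp
qed

text \<open>The determinant is a quadratic form in (x, y) whose coefficients are the three minors
  times 2, 4 and 2. The points (1, 0), (0, 1) and (1, 1) isolate them.\<close>

lemma odd_char_minors:
  fixes a1 :: "'a::field"
  assumes two: "(2 :: 'a) \<noteq> 0" and inj: "inj (quad_map a1 a2 a3 a4 a5 b1 b2 b3 b4 b5)"
  shows "a1 * b2 = a2 * b1" "a1 * b3 = a3 * b1" "a2 * b3 = a3 * b2"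
proof -
  note det = odd_char_determinant[OF two inj]
  have "2 * (a1 * b2 - a2 * b1) = 0"
    using det[of 1 0] by (simp add: algebra_simps)
  then show 1: "a1 * b2 = a2 * b1"
    using two by simp
  have "2 * (a2 * b3 - a3 * b2) = 0"
    using det[of 0 1] by (simp add: algebra_simps)
  then show 2: "a2 * b3 = a3 * b2"
    using two by simp
  have "2 * (2 * (a1 * b3 - a3 * b1)) + 2 * (a1 * b2 - a2 * b1) + 2 * (a2 * b3 - a3 * b2) = 0"
    using det[of 1 1] by (simp add: algebra_simps)
  then have "2 * (2 * (a1 * b3 - a3 * b1)) = 0"
    using 1 2 by simp
  then have "a1 * b3 - a3 * b1 = 0"
    using two by (simp only: mult_eq_0_iff) simp
  then show "a1 * b3 = a3 * b1" by simp
qed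

section \<open>Characteristic 2: additivity up to the mixed term, and absence of mixed terms\<close>

lemma char2_quad_val_add:
  fixes a :: "'a::comm_ring_1"
  assumes "(2 :: 'a) = 0"
  shows "quad_val a b c d e (x + x') (y + y') =
    quad_val a b c d e x y + quad_val a b c d e x' y' + b * (x * y' + x' * y)"
proof -
  have "quad_val a b c d e (x + x') (y + y') =
    quad_val a b c d e x y + quad_val a b c d e x' y' + b * (x * y' + x' * y) + 2 * (a * x * x' + c * y * y')"
    by (simp add: quad_val_def power2_eq_square algebra_simps)
  then show ?thesis by (simp add: assms)
qed

text \<open>The plane has more points than the field, so two points collide. Their sum, which is
  also their difference, is a nonzero zero of the additive map.\<close>

lemma char2_additive_kernel:
  fixes a :: "'a::{field,finite}"
  assumes two: "(2 :: 'a) = 0"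
  obtains x y where "(x, y) \<noteq> (0, 0)" "quad_val a 0 c d e x y = 0"
proof -
  have "card (UNIV :: 'a set) < card (UNIV :: ('a \<times> 'a) set)"
  proof -
    have "card {0, 1 :: 'a} \<le> card (UNIV :: 'a set)"
      by (intro card_mono) simp_all
    then show ?thesis
      unfolding UNIV_Times_UNIV[symmetric] card_cartesian_product by simp
  qed
  then have "\<not> inj (\<lambda>(x, y). quad_val a 0 c d e x y)"
    using card_inj_on_le[of "\<lambda>(x, y). quad_val a 0 c d e x y" UNIV UNIV] by auto
  then obtain x y x' y' where neq: "(x, y) \<noteq> (x', y')" and eq: "quad_val a 0 c d e x y = quad_val a 0 c d e x' y'"
    by (auto simp: inj_def)
  have "quad_val a 0 c d e (x + x') (y + y') = 2 * quad_val a 0 c d e x y"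
    by (simp add: char2_quad_val_add[OF two] eq)
  moreover have "(x + x', y + y') \<noteq> (0, 0)"
    using neq char2_uminus[OF two, of x'] char2_uminus[OF two, of y'] by (auto simp: add_eq_0_iff2)
  ultimately show ?thesis
    using that two by simp
qed

text \<open>With d = (x, y) a nonzero zero of the additive combination a2 g - b2 f, a point (m, n)
  is chosen such that adding d leaves f unchanged. The combination then forces g to be unchanged as
  well.\<close>

lemma char2_no_mixed_term:
  fixes a1 :: "'a::{field,finite}"
  assumes two: "(2 :: 'a) = 0" and inj: "inj (quad_map a1 a2 a3 a4 a5 b1 b2 b3 b4 b5)"
  shows "a2 = 0"
proof (rule ccontr)
  assume a2: "a2 \<noteq> 0"
  let ?f = "quad_val a1 a2 a3 a4 a5" and ?g = "quad_val b1 b2 b3 b4 b5"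
  obtain x y where xy: "(x, y) \<noteq> (0, 0)"
    and "quad_val (a2 * b1 - b2 * a1) 0 (a2 * b3 - b2 * a3) (a2 * b4 - b2 * a4) (a2 * b5 - b2 * a5) x y = 0"
    using char2_additive_kernel[OF two] .
  then have g: "a2 * ?g x y = b2 * ?f x y"
    by (simp add: quad_val_def algebra_simps)
  \<comment> \<open>The left side is a nonzero linear form in (m, n), hence takes every
    value.\<close>
  have "\<exists>m n. m * y + x * n = - ?f x y / a2"
  proof (cases "x = 0")
    case True
    with xy show ?thesis by (intro exI[of _ "(- ?f x y / a2) / y"] exI[of _ 0]) simp
  next
    case False
    then show ?thesis by (intro exI[of _ 0] exI[of _ "(- ?f x y / a2) / x"]) simp
  qed
  then obtain m n where mn: "m * y + x * n = - ?f x y / a2" by blast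
  have "?f (m + x) (n + y) = ?f m n"
    using a2 by (simp add: char2_quad_val_add[OF two] mn)
  moreover have "?g x y = b2 * ?f x y / a2"
    using a2 by (simp add: eq_divide_eq g mult.commute)
  then have "?g x y + b2 * (m * y + x * n) = 0"
    by (simp add: mn)
  then have "?g (m + x) (n + y) = ?g m n"
    by (simp add: char2_quad_val_add[OF two] add.assoc)
  ultimately have "quad_map a1 a2 a3 a4 a5 b1 b2 b3 b4 b5 (m + x, n + y) = quad_map a1 a2 a3 a4 a5 b1 b2 b3 b4 b5 (m, n)"
    by (simp add: quad_map_def)
  from injD[OF inj this] xy show False by simp
qed

section \<open>Characteristic 2: normal forms under linear equivalence\<close>

lemma sys_equiv_target:
  fixes e :: "'a::field"
  assumes "(2 :: 'a) = 0" "e \<noteq> 0"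
  shows "\<exists>c1 c2 c3 c4. sys_equiv 2 (quad_sys 1 0 0 d e b1 0 b3 b4 b5) (quad_sys 0 0 1 1 0 c1 0 c2 c3 c4)"
  \<comment> \<open>The old x becomes the new y, and the old linear form d x + e y becomes the new
    x.\<close>
  by (intro exI, intro sys_equiv_quad_sys_right[where r = 0 and s = 1 and t = "1 / e" and u = "- d / e"] refl)
     (use assms in simp_all)

text \<open>The cases concern the linear part, with rows (a, b) and (c, d): an off-diagonal entry is
  present, can be created by conjugation, or the matrix is scalar.\<close>

lemma char2_normal_form:
  fixes a :: "'a::{field,finite}"
  assumes two: "(2 :: 'a) = 0" and perm: "permutation_system 2 (quad_sys 1 0 0 a b 0 0 1 c d)"
  shows "sys_equiv 2 (quad_sys 1 0 0 a b 0 0 1 c d) (quad_sys 1 0 0 0 0 0 0 1 0 0) \<or>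
    (\<exists>c1 c2 c3 c4. sys_equiv 2 (quad_sys 1 0 0 a b 0 0 1 c d) (quad_sys 0 0 1 1 0 c1 0 c2 c3 c4))"
proof -
  consider "b \<noteq> 0" | "c \<noteq> 0" | "b = 0" "c = 0" "a \<noteq> d" | "b = 0" "c = 0" "a = d" by blast
  then show ?thesis
  proof cases
    case 1
    then show ?thesis using sys_equiv_target[OF two] by blast
  next
    case 2
    then obtain c1 c2 c3 c4 where "sys_equiv 2 (quad_sys 1 0 0 d c 0 0 1 b a) (quad_sys 0 0 1 1 0 c1 0 c2 c3 c4)"
      using sys_equiv_target[OF two] by blast
    from sys_equiv_trans[OF sys_equiv_swap this] show ?thesis by blast
  next
    case 3
    \<comment> \<open>The substitution x := x + y, followed by adding the second output to the
      first, preserves (x^2, y^2) and creates the off-diagonal entry a + d.\<close>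
    have "sys_equiv 2 (quad_sys 1 0 0 a b 0 0 1 c d) (quad_sys 1 0 1 a a 0 0 1 0 d)"
      by (rule sys_equiv_quad_sys_right[where r = 1 and s = 1 and t = 0 and u = 1]) (use 3 two in simp_all)
    also have "sys_equiv 2 (quad_sys 1 0 1 a a 0 0 1 0 d) (quad_sys 1 0 0 a (a + d) 0 0 1 0 d)"
      by (rule sys_equiv_quad_sys_left[where r = 1 and s = 1 and t = 0 and u = 1]) (use two in simp_all)
    finally have "sys_equiv 2 (quad_sys 1 0 0 a b 0 0 1 c d) (quad_sys 1 0 0 a (a + d) 0 0 1 0 d)" .
    moreover have "a + d \<noteq> 0"
      using 3 char2_uminus[OF two, of d] by (auto simp: add_eq_0_iff2)
    ultimately show ?thesis
      using sys_equiv_target[OF two, of "a + d"] sys_equiv_trans by blast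
  next
    case 4
    \<comment> \<open>A scalar linear part gives x^2 + a x the roots 0 and a, so injectivity leaves
      only a = 0.\<close>
    have "a ^ 2 + a * a = 0"
      using two by (simp add: power2_eq_square flip: mult_2)
    then have "quad_map 1 0 0 a b 0 0 1 c d (a, 0) = quad_map 1 0 0 a b 0 0 1 c d (0, 0)"
      using 4 by (simp add: quad_map_def quad_val_def)
    moreover have "inj (quad_map 1 0 0 a b 0 0 1 c d)"
      using perm by (simp add: permutation_system_quad_sys bij_is_inj)
    ultimately have "a = 0"
      using injD by fastforce
    with 4 have "quad_sys 1 0 0 a b 0 0 1 c d = quad_sys 1 0 0 0 0 0 0 1 0 0"
      by simp
    then show ?thesis
      by (simp add: sys_equiv_def)
  qed
qed

lemma char2_full_rank:
  fixes a1 :: "'a::{field,finite}"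
  assumes two: "(2 :: 'a) = 0" and D: "a1 * b3 - a3 * b1 \<noteq> 0"
    and perm: "permutation_system 2 (quad_sys a1 0 a3 a4 a5 b1 0 b3 b4 b5)"
  shows "sys_equiv 2 (quad_sys a1 0 a3 a4 a5 b1 0 b3 b4 b5) (quad_sys 1 0 0 0 0 0 0 1 0 0) \<or>
    (\<exists>c1 c2 c3 c4. sys_equiv 2 (quad_sys a1 0 a3 a4 a5 b1 0 b3 b4 b5) (quad_sys 0 0 1 1 0 c1 0 c2 c3 c4))"
proof -
  let ?F = "quad_sys a1 0 a3 a4 a5 b1 0 b3 b4 b5"
  define E where "E = inverse (a1 * b3 - a3 * b1)"
  have E: "(a1 * b3 - a3 * b1) * E = 1"
    using D by (simp add: E_def)
  \<comment> \<open>The inverse of the matrix of square coefficients; applied to the outputs it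
    turns the quadratic part into (x^2, y^2).\<close>
  let ?r = "b3 * E" and ?s = "- a3 * E" and ?t = "- b1 * E" and ?u = "a1 * E"
  have "?r * ?u - ?s * ?t = E"
    using arg_cong[OF E, of "\<lambda>t. t * E"] by (simp add: algebra_simps)
  moreover have "E \<noteq> 0"
    using E by auto
  ultimately have "?r * ?u - ?s * ?t \<noteq> 0"
    by simp
  then have "sys_equiv 2 ?F (quad_sys 1 0 0 (?r * a4 + ?s * b4) (?r * a5 + ?s * b5) 0 0 1 (?t * a4 + ?u * b4) (?t * a5 + ?u * b5))"
    by (rule sys_equiv_quad_sys_left) (use E in \<open>simp_all add: algebra_simps\<close>)
  then obtain a b c d where equiv: "sys_equiv 2 ?F (quad_sys 1 0 0 a b 0 0 1 c d)" by blast
  then have "permutation_system 2 (quad_sys 1 0 0 a b 0 0 1 c d)"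
    using perm sys_equiv_permutation_system by blast
  from char2_normal_form[OF two this] equiv show ?thesis
    using sys_equiv_trans by blast
qed

text \<open>The first component selects a fibre, and on it the second component is \<open>P\<close>
  plus a constant. Injectivity of the system and of \<open>P\<close> thus coincide, and finiteness
  turns both into bijectivity.\<close>

lemma char2_permutation_target_iff:
  fixes c1 :: "'a::{field,finite}"
  assumes two: "(2 :: 'a) = 0"
  shows "permutation_system 2 (quad_sys 0 0 1 1 0 c1 0 c2 c3 c4) \<longleftrightarrow>
    permutation_poly (monom c1 4 + monom (c2 + c3) 2 + monom c4 1)"
proof -
  define P where "P y = c1 * y ^ 4 + (c2 + c3) * y ^ 2 + c4 * y" for y
  let ?q = "quad_map 0 0 1 1 0 c1 0 c2 c3 c4"
  \<comment> \<open>the fibre \<open>y\<^sup>2 + x = k\<close> consists of the points \<open>(k + y\<^sup>2, y)\<close>\<close>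
  have q: "?q (k + y ^ 2, y) = (k, c1 * k ^ 2 + c3 * k + P y)" for k y
  proof -
    have "?q (k + y ^ 2, y) = (k + 2 * y ^ 2, c1 * k ^ 2 + c3 * k + P y + 2 * (c1 * k * y ^ 2))"
      by (simp add: quad_map_def quad_val_def P_def power2_eq_square power4_eq_xxxx algebra_simps)
    then show ?thesis by (simp add: two)
  qed
  have "inj ?q \<longleftrightarrow> inj P"
  proof
    assume inj: "inj ?q"
    show "inj P"
    proof (rule injI)
      fix y z assume "P y = P z"
      then have "?q (0 + y ^ 2, y) = ?q (0 + z ^ 2, z)"
        unfolding q by simp
      from injD[OF inj this] show "y = z" by simp
    qed
  next
    assume inj: "inj P"
    show "inj ?q"
    proof (rule injI, safe)
      fix x y x' y' assume eq: "?q (x, y) = ?q (x', y')"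
      then have "?q ((x - y ^ 2) + y ^ 2, y) = ?q ((x' - y' ^ 2) + y' ^ 2, y')"
        by simp
      then have k: "x - y ^ 2 = x' - y' ^ 2" and "P y = P y'"
        unfolding q by auto
      from injD[OF inj this(2)] show "y = y'" .
      with k show "x = x'" by simp
    qed
  qed
  moreover have "poly (monom c1 4 + monom (c2 + c3) 2 + monom c4 1) = P"
    by (simp add: fun_eq_iff P_def poly_monom)
  moreover have "bij ?q \<longleftrightarrow> inj ?q" "bij P \<longleftrightarrow> inj P"
    unfolding bij_def using finite_UNIV_inj_surj[OF finite_UNIV, of ?q] finite_UNIV_inj_surj[OF finite_UNIV, of P] by blast+
  ultimately show ?thesis
    by (simp only: permutation_system_quad_sys permutation_poly_def)
qed

text \<open>The variables separate. This covers the targets that are diagonal in x and y.\<close>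

lemma permutation_system_diagonal:
  fixes a :: "'a::{field,finite}"
  assumes "inj (\<lambda>x. a * x ^ 2 + d * x)" "inj (\<lambda>y. c * y ^ 2 + e * y)"
  shows "permutation_system 2 (quad_sys a 0 0 d 0 0 0 c 0 e)"
proof -
  have "inj (quad_map a 0 0 d 0 0 0 c 0 e)"
  proof (rule injI, safe)
    fix x y x' y' assume "quad_map a 0 0 d 0 0 0 c 0 e (x, y) = quad_map a 0 0 d 0 0 0 c 0 e (x', y')"
    then have "a * x ^ 2 + d * x = a * x' ^ 2 + d * x'" "c * y ^ 2 + e * y = c * y' ^ 2 + e * y'"
      by (simp_all add: quad_map_def quad_val_def)
    then show "x = x'" "y = y'"
      using injD[OF assms(1)] injD[OF assms(2)] by blast+
  qed
  then show ?thesis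
    unfolding permutation_system_quad_sys bij_def using finite_UNIV_inj_surj[OF finite_UNIV] by blast
qed

text \<open>The characteristic of a finite field is prime, so it is even only if it equals
  2.\<close>

lemma even_CHAR_iff: "even CHAR('a::{field,finite}) \<longleftrightarrow> (2 :: 'a) = 0"
proof -
  have "prime CHAR('a)"
    by (intro prime_CHAR_semidom finite_imp_CHAR_pos finite_UNIV)
  then have "even CHAR('a) \<longleftrightarrow> CHAR('a) dvd 2"
    using primes_dvd_imp_eq two_is_prime_nat by (metis dvd_refl)
  also have "\<dots> \<longleftrightarrow> (2 :: 'a) = 0"
    using of_nat_eq_0_iff_char_dvd[of 2, where ?'a = 'a] by simp
  finally show ?thesis .
qed

theorem theorem3p1:
  fixes a1 a2 a3 a4 a5 b1 b2 b3 b4 b5 :: "'a::{field,finite}"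
    and x y f1 f2 :: "'a mpoly" and F :: "'a mpoly vec" and p :: nat
  assumes p: "p = CHAR('a)"
    and x: "x = Var 0" and y: "y = Var 1"
    and f1: "f1 = Const a1 * x^2 + Const a2 * x * y + Const a3 * y^2 + Const a4 * x + Const a5 * y"
    and f2: "f2 = Const b1 * x^2 + Const b2 * x * y + Const b3 * y^2 + Const b4 * x + Const b5 * y"
    and F: "F = vec_of_list [f1, f2]"
  shows "permutation_system 2 F \<longleftrightarrow>
    (odd p \<longrightarrow> sys_equiv 2 F (vec_of_list [x, y])) \<and>
    (even p \<longrightarrow>
       sys_equiv 2 F (vec_of_list [x, y]) \<or>
       sys_equiv 2 F (vec_of_list [x^2, y]) \<or>
       sys_equiv 2 F (vec_of_list [x, y^2]) \<or>
       sys_equiv 2 F (vec_of_list [x^2, y^2]) \<or>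
       (\<exists>c1 c2 c3 c4 :: 'a.
          sys_equiv 2 F
            (vec_of_list [y^2 + x, Const c1 * x^2 + Const c2 * y^2 + Const c3 * x + Const c4 * y]) \<and>
          permutation_poly (monom c1 4 + monom (c2 + c3) 2 + monom c4 1)))"
proof -
  let ?id = "quad_sys 0 0 0 1 0 0 0 0 0 (1 :: 'a)" and ?X2Y = "quad_sys 1 0 0 0 0 0 0 0 0 (1 :: 'a)"
  let ?XY2 = "quad_sys 0 0 0 1 0 0 0 1 0 (0 :: 'a)" and ?X2Y2 = "quad_sys 1 0 0 0 0 0 0 1 0 (0 :: 'a)"
  let ?T = "\<lambda>c1 c2 c3 c4 :: 'a. quad_sys 0 0 1 1 0 c1 0 c2 c3 c4"
  have F: "F = quad_sys a1 a2 a3 a4 a5 b1 b2 b3 b4 b5"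
    by (simp only: F f1 f2 x y quad_sys_def quad_def)
  have targets: "vec_of_list [x, y] = ?id" "vec_of_list [x ^ 2, y] = ?X2Y" "vec_of_list [x, y ^ 2] = ?XY2"
    "vec_of_list [x ^ 2, y ^ 2] = ?X2Y2"
    "vec_of_list [y ^ 2 + x, Const c1 * x ^ 2 + Const c2 * y ^ 2 + Const c3 * x + Const c4 * y] = ?T c1 c2 c3 c4"
    for c1 c2 c3 c4
    by (simp_all add: quad_sys_def quad_def x y Const_hom)
  have even_iff: "even p \<longleftrightarrow> (2 :: 'a) = 0"
    by (simp add: p even_CHAR_iff)
  note transfer = sys_equiv_permutation_system[of 2 F]
  have perm_id: "permutation_system 2 ?id"
    by (rule permutation_system_diagonal) simp_all
  have perm_char2: "permutation_system 2 ?X2Y" "permutation_system 2 ?XY2" "permutation_system 2 ?X2Y2" if "(2 :: 'a) = 0"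
    using char2_inj_square[OF that] by (auto intro!: permutation_system_diagonal)
  show ?thesis
    unfolding targets even_iff
  proof (cases "(2 :: 'a) = 0")
    case False
    have "sys_equiv 2 F ?id" if perm: "permutation_system 2 F"
    proof -
      have "inj (quad_map a1 a2 a3 a4 a5 b1 b2 b3 b4 b5)"
        using perm by (simp add: F permutation_system_quad_sys bij_is_inj)
      from permutation_proportional[OF perm[unfolded F] odd_char_minors[OF False this]] False
      show ?thesis unfolding F by blast
    qed
    with transfer perm_id False show "permutation_system 2 F \<longleftrightarrow> ((2 :: 'a) \<noteq> 0 \<longrightarrow> sys_equiv 2 F ?id) \<and>
      ((2 :: 'a) = 0 \<longrightarrow> sys_equiv 2 F ?id \<or> sys_equiv 2 F ?X2Y \<or> sys_equiv 2 F ?XY2 \<or> sys_equiv 2 F ?X2Y2 \<or>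
        (\<exists>c1 c2 c3 c4. sys_equiv 2 F (?T c1 c2 c3 c4) \<and> permutation_poly (monom c1 4 + monom (c2 + c3) 2 + monom c4 1)))"
      by blast
  next
    case True
    have "sys_equiv 2 F ?id \<or> sys_equiv 2 F ?X2Y \<or> sys_equiv 2 F ?X2Y2 \<or> (\<exists>c1 c2 c3 c4. sys_equiv 2 F (?T c1 c2 c3 c4))"
      if perm: "permutation_system 2 F"
    proof -
      have "inj (quad_map a1 a2 a3 a4 a5 b1 b2 b3 b4 b5)"
        using perm by (simp add: F permutation_system_quad_sys bij_is_inj)
      note a2 = char2_no_mixed_term[OF True this]
      \<comment> \<open>After the swap \<open>b2\<close> is the mixed coefficient of the first
        component.\<close>
      have "permutation_system 2 (quad_sys b3 b2 b1 b5 b4 a3 a2 a1 a5 a4)"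
        using perm sys_equiv_permutation_system[OF sys_equiv_swap] unfolding F by blast
      then have "inj (quad_map b3 b2 b1 b5 b4 a3 a2 a1 a5 a4)"
        by (simp add: permutation_system_quad_sys bij_is_inj)
      note b2 = char2_no_mixed_term[OF True this]
      show ?thesis
      proof (cases "a1 * b3 - a3 * b1 = 0")
        case singular: True
        \<comment> \<open>Without mixed terms the other two minors vanish automatically.\<close>
        from permutation_proportional[OF perm[unfolded F]] singular a2 b2 show ?thesis
          unfolding F by auto
      next
        case False
        show ?thesis
          using char2_full_rank[OF True False] perm unfolding F a2 b2 by blast
      qed
    qed
    \<comment> \<open>Once \<open>F\<close> is equivalent to such a target, the side condition on
      the linearized polynomial is the permutation property itself; this serves both
      directions.\<close>
    moreover have "permutation_system 2 F \<longleftrightarrow> permutation_poly (monom c1 4 + monom (c2 + c3) 2 + monom c4 1)"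
      if "sys_equiv 2 F (?T c1 c2 c3 c4)" for c1 c2 c3 c4
      using transfer[OF that] char2_permutation_target_iff[OF True] by simp
    ultimately show "permutation_system 2 F \<longleftrightarrow> ((2 :: 'a) \<noteq> 0 \<longrightarrow> sys_equiv 2 F ?id) \<and>
      ((2 :: 'a) = 0 \<longrightarrow> sys_equiv 2 F ?id \<or> sys_equiv 2 F ?X2Y \<or> sys_equiv 2 F ?XY2 \<or> sys_equiv 2 F ?X2Y2 \<or>
        (\<exists>c1 c2 c3 c4. sys_equiv 2 F (?T c1 c2 c3 c4) \<and> permutation_poly (monom c1 4 + monom (c2 + c3) 2 + monom c4 1)))"
      using transfer perm_id perm_char2[OF True] True by meson
  qed
qed

end
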